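(* Let $E\subset\mathbb R^2$ be compact with $\dim_{\mathcal H}(E)>7/4$. Then the set $$\left\{\left(\tfrac12\left|\det[x-w,\,y-w]\right|,\ \tfrac12\left|\det[y-w,\,z-w]\right|\right) : x,y,z,w\in E\right\}$$ has nonempty interior in $\mathbb R^2$.
   Context: $\dim_{\mathcal H}$ denotes Hausdorff dimension; $\det[u,v]$ is the determinant of the $2\times2$ matrix with columns $u,v\in\mathbb R^2$. *)

theory Defs
  imports "HOL-Analysis.Analysis"
begin

definition hausdorff_pre :: "real \<Rightarrow> real \<Rightarrow> 'a::metric_space set \<Rightarrow> ennreal" where
  "hausdorff_pre s \<delta> E =
     (INF U \<in> {U :: nat \<Rightarrow> 'a set. E \<subseteq> (\<Union>i. U i) \<and>
                 (\<forall>i. bounded (U i) \<and> diameter (U i) \<le> \<delta>)}.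
        (\<Sum>i. ennreal (diameter (U i) powr s)))"

definition hausdorff_measure :: "real \<Rightarrow> 'a::metric_space set \<Rightarrow> ennreal" where
  "hausdorff_measure s E = (SUP \<delta> \<in> {0<..}. hausdorff_pre s \<delta> E)"

definition hausdorff_dim :: "'a::metric_space set \<Rightarrow> real" where
  "hausdorff_dim E = Inf {s. s \<ge> 0 \<and> hausdorff_measure s E = 0}"

definition det2 :: "real^2 \<Rightarrow> real^2 \<Rightarrow> real" where
  "det2 u v = u$1 * v$2 - u$2 * v$1"

end

(*
Fix a vertex p of E and put u, v for the coordinates relative to p. For fixed y the number det[x-p, y-p]
equals v(y) (u(x) - q v(x)) with q = u(y)/v(y), so it takes the value t exactly when x lies on the line
u = t/v(y) + q v. Hence the density at (t1, t2) of the pair of determinants is the integral over y of the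
product of two X-ray transforms of a Frostman measure of dimension s on E, evaluated at the line
parameters (t1/v(y), q) and (t2/v(y), q). It suffices to show that passing from resolution r to r/2
changes this density by O(r^(2s - 7/2)), which is summable because s > 7/4. One factor is bounded
trivially by the mass of a strip, O(r^(s-2)). The difference of the other factor between the two scales has
squared L2 norm O(r^(s-1)) in the space of lines, by cancellation of a mean-zero kernel (no Fourier
transform is needed), and restricting to the s-dimensional family of lines (t/v(y), q) costs another
factor r^(s-2). Weak limits of measures are avoided: at every scale one uses a finite weighted subset of E
that is a Frostman measure down to that scale, and a pigeonhole argument together with the
compactness of E gives the exact determinants.
*)
theory Submission
  imports Defs
begin

section \<open>Discrete Frostman measures\<close>

text \<open>Cancellation is indispensable. The strips attached to two points at distance
  \<open>d\<close> overlap, in parameter space, in area of order \<open>r * (r / d)\<close>; after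
  normalisation the weight is \<open>1 / d\<close>, and as \<open>s > 1\<close> these weights sum to
  O(1) with far pairs contributing fully, so there is no decay in \<open>r\<close>. Mean zero
  supplies a second factor \<open>r / d\<close>; as \<open>s < 2\<close>, near pairs then dominate,
  and this is the source of the gain. An L2 bound on the space of lines says nothing about the
  single lines attached to the points \<open>y\<close>. Densities are therefore averaged over small
  squares of parameters, where Cauchy-Schwarz applies. The map from \<open>y\<close> to
  \<open>(t / v y, u y / v y)\<close> degenerates at \<open>t = 0\<close> and at
  \<open>v y = 0\<close>. Points close to the line \<open>v = 0\<close> and pairs with small
  determinant are discarded; since \<open>s > 1\<close>, thin strips carry little mass and enough
  remains. All constants depend only on \<open>s\<close>, \<open>C\<close> and \<open>L\<close>, so
  a starting scale can be fixed before the resolution tends to 0, and the lower bound found there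
  survives every later step.\<close>

text \<open>Starting from the finest level, the mass of every cell exceeding its cap is scaled down to the cap;
  afterwards each point lies in a cell whose cap is attained.\<close>

lemma capped_weights:
  fixes D :: "nat \<Rightarrow> 'a \<Rightarrow> 'b" and cap :: "nat \<Rightarrow> real"
  assumes X: "finite X" and cap: "\<And>j. 0 < cap j"
    and nested: "\<And>i j x y. i \<le> j \<Longrightarrow> D j x = D j y \<Longrightarrow> D i x = D i y"
    and inj: "inj_on (D n) X" and kn: "k \<le> n"
  shows "\<exists>w. (\<forall>x\<in>X. 0 \<le> w x) \<and> (\<forall>j\<in>{k..n}. \<forall>x\<in>X. (\<Sum>y\<in>{y\<in>X. D j y = D j x}. w y) \<le> cap j)
      \<and> (\<forall>x\<in>X. \<exists>j\<in>{k..n}. (\<Sum>y\<in>{y\<in>X. D j y = D j x}. w y) = cap j)"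
  using kn
proof (induction rule: inc_induct)
  case base
  have "{y\<in>X. D n y = D n x} = {x}" if "x \<in> X" for x using that inj by (auto simp: inj_on_def)
  then show ?case using cap[of n] by (intro exI[of _ "\<lambda>_. cap n"]) auto
next
  case (step m)
  then obtain w where w: "\<And>x. x \<in> X \<Longrightarrow> 0 \<le> w x"
    and le: "\<And>j x. j \<in> {Suc m..n} \<Longrightarrow> x \<in> X \<Longrightarrow> (\<Sum>y\<in>{y\<in>X. D j y = D j x}. w y) \<le> cap j"
    and tight: "\<And>x. x \<in> X \<Longrightarrow> \<exists>j\<in>{Suc m..n}. (\<Sum>y\<in>{y\<in>X. D j y = D j x}. w y) = cap j"
    by blast
  define M where "M = (\<lambda>x. \<Sum>y\<in>{y\<in>X. D m y = D m x}. w y)"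
  define f where "f = (\<lambda>x. if M x > cap m then cap m / M x else 1)"
  have f: "0 \<le> f x" "f x \<le> 1" for x using cap[of m] by (auto simp: f_def divide_le_eq)
  \<comment> \<open>\<open>f\<close> is constant on every cell of level at least \<open>m\<close>,
    so each finer mass is multiplied by one factor at most 1. A cell that loses its tightness this
    way lies in a level \<open>m\<close> cell that has just become tight.\<close>
  have sums: "(\<Sum>y\<in>{y\<in>X. D j y = D j x}. f y * w y) = f x * (\<Sum>y\<in>{y\<in>X. D j y = D j x}. w y)" if "m \<le> j" for j x
    unfolding sum_distrib_left
  proof (intro sum.cong refl)
    fix y assume "y \<in> {y\<in>X. D j y = D j x}"
    then have "D m y = D m x" using nested[OF that] by blast
    then have "f y = f x" unfolding f_def M_def by simp
    then show "f y * w y = f x * w y" by simp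
  qed
  have pos: "0 \<le> (\<Sum>y\<in>{y\<in>X. D j y = D j x}. w y)" for j x using w by (intro sum_nonneg) auto
  show ?case
  proof (intro exI[of _ "\<lambda>x. f x * w x"] conjI ballI)
    fix x assume x: "x \<in> X"
    show "0 \<le> f x * w x" using f w x by simp
    show "\<exists>j\<in>{m..n}. (\<Sum>y\<in>{y\<in>X. D j y = D j x}. f y * w y) = cap j"
    proof (cases "M x > cap m")
      case True
      have "(\<Sum>y\<in>{y\<in>X. D m y = D m x}. f y * w y) = cap m"
        unfolding sums[OF order_refl] using True cap[of m] by (simp add: f_def M_def)
      then show ?thesis using step by auto
    next
      case False
      then have "f x = 1" by (simp add: f_def)
      obtain j where "j \<in> {Suc m..n}" "(\<Sum>y\<in>{y\<in>X. D j y = D j x}. w y) = cap j" using tight[OF x] by blast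
      then show ?thesis using sums[of j x] \<open>f x = 1\<close> by (intro bexI[of _ j]) auto
    qed
  next
    fix j x assume j: "j \<in> {m..n}" and x: "x \<in> X"
    show "(\<Sum>y\<in>{y\<in>X. D j y = D j x}. f y * w y) \<le> cap j"
    proof (cases "j = m")
      case True
      show ?thesis unfolding True sums[OF order_refl] using cap[of m] by (auto simp: f_def M_def)
    next
      case False
      then have "j \<in> {Suc m..n}" using j by auto
      then have "(\<Sum>y\<in>{y\<in>X. D j y = D j x}. w y) \<le> cap j" using le x by blast
      moreover have "f x * (\<Sum>y\<in>{y\<in>X. D j y = D j x}. w y) \<le> 1 * (\<Sum>y\<in>{y\<in>X. D j y = D j x}. w y)"
        using f pos by (intro mult_right_mono) auto
      ultimately show ?thesis using sums[of j x] j by simp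
    qed
  qed
qed

text \<open>The least tight level of \<open>x\<close> gives the coarsest tight cell around
  \<open>x\<close>. By nestedness two such cells coincide or are disjoint, so their caps add up
  exactly to the total mass. This turns the weights into a cover that competes in
  \<open>hausdorff_pre\<close> and bounds the mass from below.\<close>

lemma tight_cells_cover:
  fixes D :: "nat \<Rightarrow> 'a \<Rightarrow> 'b" and cap w
  assumes X: "finite X"
    and nested: "\<And>i j x y. i \<le> j \<Longrightarrow> D j x = D j y \<Longrightarrow> D i x = D i y"
    and tight: "\<And>x. x \<in> X \<Longrightarrow> \<exists>j\<in>{k..n}. (\<Sum>y\<in>{y\<in>X. D j y = D j x}. w y) = cap j"
  shows "\<exists>P. finite P \<and> fst ` P \<subseteq> {k..n} \<and> (\<forall>x\<in>X. \<exists>p\<in>P. D (fst p) x = snd p) \<and> sum w X = (\<Sum>p\<in>P. (cap (fst p) :: real))"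
proof -
  define T where "T = (\<lambda>x j. j \<in> {k..n} \<and> (\<Sum>y\<in>{y\<in>X. D j y = D j x}. w y) = cap j)"
  define J where "J = (\<lambda>x. LEAST j. T x j)"
  define g where "g = (\<lambda>x. (J x, D (J x) x))"
  have TJ: "T x (J x)" if "x \<in> X" for x unfolding J_def using tight[OF that] by (intro LeastI_ex[of "T x"]) (auto simp: T_def)
  have Jle: "J x \<le> j" if "T x j" for x j unfolding J_def using that by (rule Least_le)
  have same: "T x j = T y j" if "D j x = D j y" for x y j using that by (simp add: T_def)
  have fib: "{y\<in>X. g y = g x} = {y\<in>X. D (J x) y = D (J x) x}" if x: "x \<in> X" for x
  proof safe
    fix y assume y: "y \<in> X" "D (J x) y = D (J x) x"
    have "T y (J x)" using same[OF y(2)] TJ[OF x] by simp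
    then have 1: "J y \<le> J x" by (rule Jle)
    have "D (J y) y = D (J y) x" using nested[OF 1 y(2)] .
    then have "T x (J y)" using same TJ[OF y(1)] by blast
    then have "J x \<le> J y" by (rule Jle)
    with 1 have "J y = J x" by simp
    then show "g y = g x" using y by (simp add: g_def)
  qed (auto simp: g_def)
  have "sum w X = (\<Sum>p\<in>g ` X. sum w {y\<in>X. g y = p})" using X by (rule sum.image_gen)
  also have "\<dots> = (\<Sum>p\<in>g ` X. cap (fst p))"
  proof (intro sum.cong refl)
    fix p assume "p \<in> g ` X"
    then obtain x where x: "x \<in> X" "p = g x" by blast
    show "sum w {y\<in>X. g y = p} = cap (fst p)" 
      unfolding x(2) fib[OF x(1)] using TJ[OF x(1)] by (simp add: T_def g_def)
  qed
  finally have "sum w X = (\<Sum>p\<in>g ` X. cap (fst p))" .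
  moreover have "fst ` g ` X \<subseteq> {k..n}" using TJ by (auto simp: g_def T_def)
  moreover have "\<forall>x\<in>X. \<exists>p\<in>g ` X. D (fst p) x = snd p" by (auto simp: g_def)
  ultimately show ?thesis using X by (intro exI[of _ "g ` X"]) auto
qed

section \<open>Dyadic squares, coverings and Hausdorff content\<close>

definition dyadic :: "nat \<Rightarrow> real^2 \<Rightarrow> int \<times> int" where
  "dyadic k x = (\<lfloor>2^k * x$1\<rfloor>, \<lfloor>2^k * x$2\<rfloor>)"

lemma dyadic_nested: "i \<le> j \<Longrightarrow> dyadic j x = dyadic j y \<Longrightarrow> dyadic i x = dyadic i y"
proof (induction rule: dec_induct)
  case (step n)
  have "\<lfloor>2^n * a\<rfloor> = \<lfloor>2^Suc n * a\<rfloor> div 2" for a :: real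
  proof -
    have "\<lfloor>2^n * a\<rfloor> = \<lfloor>(2^Suc n * a) / real_of_int 2\<rfloor>" by simp
    then show ?thesis by (simp only: floor_divide_real_eq_div) 
  qed
  then have "dyadic n x = dyadic n y" using step.prems unfolding dyadic_def by (metis prod.inject)
  then show ?case by (rule step.IH)
qed simp

lemma dyadic_dist:
  assumes "dyadic k x = dyadic k y" shows "dist x y \<le> 2 * (1/2)^k"
proof -
  have "\<bar>a - b\<bar> \<le> (1/2)^k" if "\<lfloor>2^k * a\<rfloor> = \<lfloor>2^k * b\<rfloor>" for a b :: real
  proof -
    have "\<bar>2^k * a - 2^k * b\<bar> \<le> 1" using that by linarith
    then have "2^k * \<bar>a - b\<bar> \<le> 1" by (simp add: abs_mult flip: right_diff_distrib)
    then show ?thesis by (simp add: field_simps)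
  qed
  then have "\<bar>x$1 - y$1\<bar> \<le> (1/2)^k" "\<bar>x$2 - y$2\<bar> \<le> (1/2)^k" using assms by (auto simp: dyadic_def)
  moreover have "dist x y \<le> \<bar>x$1 - y$1\<bar> + \<bar>x$2 - y$2\<bar>"
    using norm_le_l1_cart[of "x - y"] by (simp add: dist_norm sum_2)
  ultimately show ?thesis by simp
qed

lemma finite_dyadic_image:
  assumes "bounded E" shows "finite (dyadic k ` E)"
proof -
  obtain M where M: "\<And>x. x \<in> E \<Longrightarrow> norm x \<le> M" using assms by (auto simp: bounded_iff)
  define m where "m = \<lceil>2^k * M\<rceil>"
  have "dyadic k x \<in> {-m..m} \<times> {-m..m}" if x: "x \<in> E" for x
  proof -
    have "- real_of_int m \<le> 2^k * x$i \<and> 2^k * x$i \<le> real_of_int m" for i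
    proof -
      have "\<bar>x$i\<bar> \<le> M" using component_le_norm_cart[of x i] M[OF x] by simp
      then have "2^k * \<bar>x$i\<bar> \<le> 2^k * M" by simp
      also have "\<dots> \<le> real_of_int m" by (simp add: m_def)
      finally have "\<bar>2^k * x$i\<bar> \<le> real_of_int m" by (simp add: abs_mult)
      then show ?thesis by (simp add: abs_le_iff)
    qed
    then show ?thesis unfolding dyadic_def by (auto simp: le_floor_iff floor_le_iff) (smt (verit))+
  qed
  then have "dyadic k ` E \<subseteq> {-m..m} \<times> {-m..m}" by blast
  then show ?thesis using finite_subset by blast
qed

lemma hausdorff_pre_le_sum:
  assumes P: "finite P" and cover: "E \<subseteq> (\<Union>p\<in>P. V p)" and V: "\<And>p. p \<in> P \<Longrightarrow> bounded (V p) \<and> diameter (V p) \<le> \<delta>" and \<delta>: "0 \<le> \<delta>"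
  shows "hausdorff_pre s \<delta> E \<le> ennreal (\<Sum>p\<in>P. diameter (V p) powr s)"
proof -
  obtain h where h: "bij_betw h {..<card P} P" using ex_bij_betw_nat_finite[OF P] by (auto simp: atLeast0LessThan)
  \<comment> \<open>Padding by empty sets costs nothing: their diameter is 0, and
    \<open>0 powr s\<close> is 0 for every \<open>s\<close>.\<close>
  define U where "U = (\<lambda>i. if i < card P then V (h i) else {})"
  have hP: "h i \<in> P" if "i < card P" for i using h that by (auto simp: bij_betw_def)
  have "hausdorff_pre s \<delta> E \<le> (\<Sum>i. ennreal (diameter (U i) powr s))"
    unfolding hausdorff_pre_def
  proof (rule INF_lower, safe)
    fix x assume "x \<in> E"
    then obtain p where p: "p \<in> P" "x \<in> V p" using cover by blast
    then obtain i where "i < card P" "p = h i" using h by (auto simp: bij_betw_def)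
    then show "x \<in> (\<Union>i. U i)" using p by (auto simp: U_def)
  next
    fix i show "bounded (U i)" "diameter (U i) \<le> \<delta>" using V hP \<delta> by (auto simp: U_def)
  qed
  also have "\<dots> = (\<Sum>i<card P. ennreal (diameter (U i) powr s))"
    by (rule suminf_finite) (auto simp: U_def)
  also have "\<dots> = (\<Sum>i<card P. ennreal (diameter (V (h i)) powr s))" by (intro sum.cong) (auto simp: U_def)
  also have "\<dots> = (\<Sum>p\<in>P. ennreal (diameter (V p) powr s))"
    using h by (intro sum.reindex_bij_betw)
  also have "\<dots> = ennreal (\<Sum>p\<in>P. diameter (V p) powr s)" by simp
  finally show ?thesis .
qed

text \<open>The constants do not depend on the scale \<open>n\<close>; this replaces the Frostman measure.\<close>

lemma discrete_frostman:
  fixes E :: "(real^2) set"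
  assumes E: "bounded E" and \<delta>: "0 < \<delta>" and pre: "hausdorff_pre s \<delta> E \<noteq> 0" and s: "0 < s"
  shows "\<exists>c>0. \<exists>C\<ge>1. \<forall>n. \<exists>X w. finite X \<and> X \<subseteq> E \<and> (\<forall>x\<in>X. 0 \<le> w x) \<and> c \<le> sum w X \<and>
     (\<forall>a b \<rho>. (1/2)^n \<le> \<rho> \<longrightarrow> (\<Sum>x\<in>{x\<in>X. \<bar>x$1 - a\<bar> \<le> \<rho> \<and> \<bar>x$2 - b\<bar> \<le> \<rho>}. w x) \<le> C * \<rho> powr s)"
proof -
  obtain c where c: "0 < c" "ennreal c \<le> hausdorff_pre s \<delta> E"
  proof (cases "hausdorff_pre s \<delta> E")
    case (real r)
    then have "0 < r" using pre by (cases "r = 0") auto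
    then show ?thesis using that[of r] real by simp
  next
    case top
    then show ?thesis using that[of 1] by simp
  qed
  \<comment> \<open>Squares of level at least \<open>k0\<close> have diameter at most \<delta>, so
    covers made of them are admissible.\<close>
  obtain k0 where k0: "2 * (1/2)^k0 \<le> \<delta>"
    using real_arch_pow_inv[of "\<delta>/2" "1/2"] \<delta> by (auto simp: field_simps intro: less_imp_le)
  define K where "K = card (dyadic k0 ` E)"
  \<comment> \<open>Boxes smaller than level \<open>k0\<close> meet at most 6 squares per coordinate
    at the comparable level, hence 36; larger boxes are charged with all \<open>K\<close> occupied
    squares of level \<open>k0\<close>.\<close>
  define C where "C = max 36 (real K)"
  define cap :: "nat \<Rightarrow> real" where "cap = (\<lambda>j. ((1/2)^j) powr s)"
  have cap: "0 < cap j" for j by (simp add: cap_def)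
  have main: "\<exists>X w. finite X \<and> X \<subseteq> E \<and> (\<forall>x\<in>X. 0 \<le> w x) \<and> c / 2 powr s \<le> sum w X \<and>
     (\<forall>a b \<rho>. (1/2)^n \<le> \<rho> \<longrightarrow> (\<Sum>x\<in>{x\<in>X. \<bar>x$1 - a\<bar> \<le> \<rho> \<and> \<bar>x$2 - b\<bar> \<le> \<rho>}. w x) \<le> C * \<rho> powr s)"
    if n: "k0 \<le> n" for n
  proof -
    \<comment> \<open>One point of \<open>E\<close> per occupied square of level \<open>n\<close>:
      the points stay in \<open>E\<close>, and \<open>dyadic n\<close> is injective on them, as
      \<open>capped_weights\<close> requires.\<close>
    define rep where "rep = (\<lambda>c. SOME x. x \<in> E \<and> dyadic n x = c)"
    define X where "X = rep ` (dyadic n ` E)"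
    have rep: "rep (dyadic n x) \<in> E" "dyadic n (rep (dyadic n x)) = dyadic n x" if "x \<in> E" for x
      using someI[of "\<lambda>y. y \<in> E \<and> dyadic n y = dyadic n x" x] that by (auto simp: rep_def)
    have fX: "finite X" unfolding X_def using finite_dyadic_image[OF E] by blast
    have XE: "X \<subseteq> E" using rep by (auto simp: X_def)
    have inj: "inj_on (dyadic n) X" using rep by (auto simp: X_def inj_on_def)
    obtain w where w': "\<forall>x\<in>X. 0 \<le> w x"
      and le': "\<forall>j\<in>{k0..n}. \<forall>x\<in>X. (\<Sum>y\<in>{y\<in>X. dyadic j y = dyadic j x}. w y) \<le> cap j"
      and tight': "\<forall>x\<in>X. \<exists>j\<in>{k0..n}. (\<Sum>y\<in>{y\<in>X. dyadic j y = dyadic j x}. w y) = cap j"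
    proof -
      have "\<exists>w. (\<forall>x\<in>X. 0 \<le> w x) \<and> (\<forall>j\<in>{k0..n}. \<forall>x\<in>X. (\<Sum>y\<in>{y\<in>X. dyadic j y = dyadic j x}. w y) \<le> cap j)
        \<and> (\<forall>x\<in>X. \<exists>j\<in>{k0..n}. (\<Sum>y\<in>{y\<in>X. dyadic j y = dyadic j x}. w y) = cap j)"
        by (rule capped_weights) (rule fX cap inj n | erule (1) dyadic_nested)+
      then show ?thesis by (elim exE conjE) (rule that)
    qed
    note w = w'[rule_format] and le = le'[rule_format] and tight = tight'[rule_format]
    obtain P where P: "finite P" "fst ` P \<subseteq> {k0..n}" "\<forall>x\<in>X. \<exists>p\<in>P. dyadic (fst p) x = snd p" 
      and wP: "sum w X = (\<Sum>p\<in>P. cap (fst p))"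
    proof -
      have "\<exists>P. finite P \<and> fst ` P \<subseteq> {k0..n} \<and> (\<forall>x\<in>X. \<exists>p\<in>P. dyadic (fst p) x = snd p) \<and> sum w X = (\<Sum>p\<in>P. cap (fst p))"
        by (rule tight_cells_cover) (rule fX | erule (1) dyadic_nested | erule tight)+
      then show ?thesis by (elim exE conjE) (rule that)
    qed
    define V where "V = (\<lambda>p. {x\<in>E. dyadic (fst p) x = snd p})"
    have dV: "diameter (V p) \<le> 2 * (1/2)^fst p" for p
    proof (rule diameter_le)
      fix x y assume "x \<in> V p" "y \<in> V p"
      then show "norm (x - y) \<le> 2 * (1/2)^fst p" using dyadic_dist[of "fst p" x y] by (simp add: V_def dist_norm)
    qed simp
    have "ennreal c \<le> ennreal (\<Sum>p\<in>P. diameter (V p) powr s)"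
    proof (rule order_trans[OF c(2) hausdorff_pre_le_sum[OF P(1)]])
      \<comment> \<open>A point of \<open>E\<close> shares its level \<open>n\<close> square with a
        representative, hence all coarser squares too; so squares that catch \<open>X\<close> catch
        all of \<open>E\<close>.\<close>
      show "E \<subseteq> (\<Union>p\<in>P. V p)"
      proof
        fix x assume x: "x \<in> E"
        define x' where "x' = rep (dyadic n x)"
        have "x' \<in> X" using x by (auto simp: X_def x'_def)
        then obtain p where p: "p \<in> P" "dyadic (fst p) x' = snd p" using P(3) by blast
        have "fst p \<le> n" using P(2) p by auto
        then have "dyadic (fst p) x = snd p" using p dyadic_nested[of "fst p" n x x'] rep(2)[OF x] by (simp add: x'_def)
        then show "x \<in> (\<Union>p\<in>P. V p)" using p x by (auto simp: V_def)
      qed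
      fix p assume p: "p \<in> P"
      have "bounded (V p)" using E by (rule bounded_subset) (auto simp: V_def)
      moreover have "(1/2::real)^fst p \<le> (1/2)^k0" using P(2) p by (intro power_decreasing) auto
      ultimately show "bounded (V p) \<and> diameter (V p) \<le> \<delta>" using dV[of p] k0 by linarith
    qed (use \<delta> in simp)
    then have "c \<le> (\<Sum>p\<in>P. diameter (V p) powr s)" by (simp add: sum_nonneg)
    also have "\<dots> \<le> (\<Sum>p\<in>P. 2 powr s * cap (fst p))"
    proof (intro sum_mono)
      fix p assume "p \<in> P"
      have "diameter (V p) powr s \<le> (2 * (1/2)^fst p) powr s"
        using dV E s by (intro powr_mono2 diameter_ge_0) (auto intro: bounded_subset simp: V_def)
      also have "\<dots> = 2 powr s * cap (fst p)" by (simp add: cap_def powr_mult)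
      finally show "diameter (V p) powr s \<le> 2 powr s * cap (fst p)" .
    qed
    also have "\<dots> = 2 powr s * sum w X" by (simp add: wP sum_distrib_left)
    finally have mass: "c / 2 powr s \<le> sum w X" by (simp add: field_simps)
    have count: "sum w S \<le> real (card I) * cap j" if S: "S \<subseteq> X" "dyadic j ` S \<subseteq> I" "finite I" and j: "j \<in> {k0..n}" for S I j
    proof -
      have "sum w S = (\<Sum>i\<in>I. sum w {x\<in>S. dyadic j x = i})"
        by (rule sum.group[symmetric]) (use S fX in \<open>auto intro: finite_subset[OF S(1)]\<close>)
      also have "\<dots> \<le> (\<Sum>i\<in>I. cap j)"
      proof (rule sum_mono)
        fix i assume "i \<in> I"
        show "sum w {x\<in>S. dyadic j x = i} \<le> cap j"
        proof (cases "{x\<in>S. dyadic j x = i} = {}")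
          case True
          then show ?thesis unfolding True using cap[of j] by simp
        next
          case False
          then obtain x where x: "x \<in> X" "dyadic j x = i" using S by blast
          have "sum w {x\<in>S. dyadic j x = i} \<le> (\<Sum>y\<in>{y\<in>X. dyadic j y = dyadic j x}. w y)"
            using x S fX w by (intro sum_mono2) auto
          then show ?thesis using le[OF j x(1)] by linarith
        qed
      qed
      finally show ?thesis by simp
    qed
    have "(\<Sum>x\<in>{x\<in>X. \<bar>x$1 - a\<bar> \<le> \<rho> \<and> \<bar>x$2 - b\<bar> \<le> \<rho>}. w x) \<le> C * \<rho> powr s" (is "sum w ?S \<le> _") if \<rho>: "(1/2)^n \<le> \<rho>" for a b \<rho>
    proof (cases "(1/2)^k0 \<le> \<rho>")
      case True
      have "sum w ?S \<le> real (card (dyadic k0 ` E)) * cap k0"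
        using XE n finite_dyadic_image[OF E] by (intro count) auto
      also have "\<dots> \<le> C * \<rho> powr s"
        unfolding C_def K_def cap_def using True s by (intro mult_mono powr_mono2) auto
      finally show ?thesis .
    next
      case False
      define j where "j = (LEAST j. (1/2)^j \<le> \<rho>)"
      have j1: "(1/2)^j \<le> \<rho>" "j \<le> n" unfolding j_def 
        using \<rho> LeastI[of "\<lambda>j. (1/2)^j \<le> \<rho>" n] Least_le[of "\<lambda>j. (1/2)^j \<le> \<rho>" n] by auto
      have jk: "k0 < j"
      proof (rule ccontr)
        assume "\<not> k0 < j"
        then have "(1/2::real)^k0 \<le> (1/2)^j" by (intro power_decreasing) auto
        then show False using False j1 by linarith
      qed
      then obtain j' where j': "j = Suc j'" by (cases j) auto
      have "\<not> (1/2)^j' \<le> \<rho>" using not_less_Least[of j' "\<lambda>j. (1/2)^j \<le> \<rho>"] j' by (simp add: j_def)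
      then have \<rho>2: "2^j * \<rho> < 2" by (simp add: j' field_simps)
      define I where "I = (\<lambda>a. {\<lfloor>2^j * (a - \<rho>)\<rfloor>..\<lfloor>2^j * (a + \<rho>)\<rfloor>})"
      have cI: "real (card (I a)) \<le> 6" for a
      proof (cases "\<lfloor>2^j * (a - \<rho>)\<rfloor> \<le> \<lfloor>2^j * (a + \<rho>)\<rfloor>")
        case True
        have "2^j * (a - \<rho>) = 2^j * a - 2^j * \<rho>" "2^j * (a + \<rho>) = 2^j * a + 2^j * \<rho>" by (simp_all add: algebra_simps)
        then have "\<lfloor>2^j * (a + \<rho>)\<rfloor> - \<lfloor>2^j * (a - \<rho>)\<rfloor> + 1 \<le> 6" using \<rho>2 by linarith
        then show ?thesis using True by (simp add: I_def)
      qed (simp add: I_def)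
      have "sum w ?S \<le> real (card (I a \<times> I b)) * cap j"
      proof (rule count)
        show "dyadic j ` ?S \<subseteq> I a \<times> I b"
        proof -
          have "\<lfloor>2^j * t\<rfloor> \<in> I a" if "\<bar>t - a\<bar> \<le> \<rho>" for t a
          proof -
            have "a - \<rho> \<le> t" "t \<le> a + \<rho>" using that by linarith+
            then have "2^j * (a - \<rho>) \<le> 2^j * t" "2^j * t \<le> 2^j * (a + \<rho>)" by (intro mult_left_mono; simp)+
            then show ?thesis by (simp add: I_def floor_mono)
          qed
          then show ?thesis by (auto simp: dyadic_def)
        qed
      qed (use jk j1 in \<open>auto simp: I_def\<close>)
      also have "\<dots> \<le> C * \<rho> powr s"
      proof (rule mult_mono)
        have "real (card (I a)) * real (card (I b)) \<le> 6 * 6" using cI by (intro mult_mono) auto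
        then show "real (card (I a \<times> I b)) \<le> C" by (simp add: card_cartesian_product C_def)
        show "cap j \<le> \<rho> powr s" unfolding cap_def using j1 s by (intro powr_mono2) auto
      qed (auto simp: C_def cap_def)
      finally show ?thesis .
    qed
    then show ?thesis by (intro exI[of _ X] exI[of _ w] conjI allI impI fX XE w' mass)
  qed
  show ?thesis
  proof (rule exI[of _ "c / 2 powr s"], intro conjI exI[of _ C] allI)
    fix n
    \<comment> \<open>For \<open>n < k0\<close> the set built at level \<open>k0\<close> serves,
      since its box bound reaches down to an even smaller radius.\<close>
    have "(1/2::real)^(max n k0) \<le> (1/2)^n" by (intro power_decreasing) auto
    then show "\<exists>X w. finite X \<and> X \<subseteq> E \<and> (\<forall>x\<in>X. 0 \<le> w x) \<and> c / 2 powr s \<le> sum w X \<and>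
     (\<forall>a b \<rho>. (1/2)^n \<le> \<rho> \<longrightarrow> (\<Sum>x\<in>{x\<in>X. \<bar>x$1 - a\<bar> \<le> \<rho> \<and> \<bar>x$2 - b\<bar> \<le> \<rho>}. w x) \<le> C * \<rho> powr s)"
    proof -
      obtain X w where X: "finite X" "X \<subseteq> E" "\<forall>x\<in>X. 0 \<le> w x" "c / 2 powr s \<le> sum w X"
        and box: "\<And>a b \<rho>. (1/2)^max n k0 \<le> \<rho> \<Longrightarrow> 
          (\<Sum>x\<in>{x\<in>X. \<bar>x$1 - a\<bar> \<le> \<rho> \<and> \<bar>x$2 - b\<bar> \<le> \<rho>}. w x) \<le> C * \<rho> powr s"
        using main[of "max n k0"] by auto
      show ?thesis
        by (intro exI[of _ X] exI[of _ w] conjI allI impI box X) 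
          (erule order_trans[OF \<open>(1/2)^max n k0 \<le> (1/2)^n\<close>])
    qed
  qed (use c in \<open>auto simp: C_def\<close>)
qed

lemma hausdorff_pre_pos:
  fixes E :: "'a::metric_space set"
  assumes "hausdorff_dim E > d" "0 \<le> d" "d < e"
  shows "\<exists>s \<delta>. d < s \<and> s < e \<and> 0 < \<delta> \<and> hausdorff_pre s \<delta> E \<noteq> 0"
proof -
  \<comment> \<open>Capping at \<open>e\<close> keeps the exponent below 2 in the application;
    \<open>kernel_sum_le\<close> needs this for its geometric series.\<close>
  define s where "s = (d + min e (hausdorff_dim E)) / 2"
  have s: "d < s" "s < e" "s < hausdorff_dim E" using assms by (auto simp: s_def min_def)
  have "hausdorff_measure s E \<noteq> 0"
  proof
    assume "hausdorff_measure s E = 0"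
    then have "hausdorff_dim E \<le> s" unfolding hausdorff_dim_def using s assms
      by (intro cInf_lower bdd_belowI[of _ 0]) auto
    then show False using s by simp
  qed
  then obtain \<delta> where "0 < \<delta>" "hausdorff_pre s \<delta> E \<noteq> 0"
    unfolding hausdorff_measure_def by (metis (mono_tags, lifting) bot_ennreal greaterThan_iff SUP_bot_conv(2))
  then show ?thesis using s by blast
qed

section \<open>Correlations of mean-zero kernels\<close>

lemma integrable_bounded_support:
  fixes f :: "'a::euclidean_space \<Rightarrow> real"
  assumes "f \<in> borel_measurable borel" "bounded S" "S \<in> sets borel"
    and "\<And>x. \<bar>f x\<bar> \<le> B" and "\<And>x. x \<notin> S \<Longrightarrow> f x = 0"
  shows "integrable lborel f"
proof (rule integrableI_bounded_set)
  show "S \<in> sets lborel" using assms by simp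
  show "emeasure lborel S < \<infinity>" using assms(2) by (rule emeasure_bounded_finite)
  show "AE x in lborel. x \<in> S \<longrightarrow> norm (f x) \<le> B" using assms(4) by simp
  show "AE x in lborel. x \<notin> S \<longrightarrow> f x = 0" using assms(5) by simp
qed (use assms in simp)

lemma integral_abs_le_support:
  fixes f :: "real \<Rightarrow> real"
  assumes "f \<in> borel_measurable borel" "0 \<le> h"
    and "\<And>x. \<bar>f x\<bar> \<le> B" and "\<And>x. \<bar>x\<bar> > h \<Longrightarrow> f x = 0"
  shows "\<bar>LINT x|lborel. f x\<bar> \<le> 2 * h * B"
proof -
  have i: "integrable lborel f"
  proof (rule integrable_bounded_support[where S="{-h..h}" and B=B])
    show "f x = 0" if "x \<notin> {-h..h}" for x using that by (intro assms(4)) auto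
  qed (use assms(1,3) in auto)
  have "\<bar>LINT x|lborel. f x\<bar> \<le> (LINT x|lborel. \<bar>f x\<bar>)" by simp
  also have "\<dots> \<le> (LINT x|lborel. B * indicator {-h..h} x)"
  proof (rule integral_mono)
    show "integrable lborel (\<lambda>x. B * indicator {-h..h} x)" using assms(2)
      by (intro integrable_mult_right integrable_real_indicator) (auto)
    show "\<bar>f x\<bar> \<le> B * indicator {-h..h} x" for x
      using assms(3)[of x] assms(4)[of x] by (auto simp: indicator_def)
  qed (use i in auto)
  also have "\<dots> = 2 * h * B" using assms(2) by simp
  finally show ?thesis .
qed

lemma integrable_kernel_product:
  fixes \<kappa> \<kappa>' \<psi> :: "real \<Rightarrow> real"
  assumes meas [measurable]: "\<kappa> \<in> borel_measurable borel" "\<kappa>' \<in> borel_measurable borel" "\<psi> \<in> borel_measurable borel"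
    and bd: "\<And>z. \<bar>\<kappa> z\<bar> \<le> m" "\<And>z. \<bar>\<kappa>' z\<bar> \<le> m" "\<And>q. \<bar>\<psi> q\<bar> \<le> 1"
    and supp: "\<And>z. \<bar>z\<bar> > h \<Longrightarrow> \<kappa>' z = 0" "\<And>q. \<bar>q\<bar> > T \<Longrightarrow> \<psi> q = 0"
  shows "integrable lborel (\<lambda>x. \<psi> (snd x) * (\<kappa> (a - fst x - snd x * b) * \<kappa>' (a' - fst x - snd x * b')))"
proof -
  have m0: "m \<ge> 0" using bd(1)[of 0] by linarith
  define f where "f = (\<lambda>p q. \<psi> q * (\<kappa> (a - p - q * b) * \<kappa>' (a' - p - q * b')))"
  have "integrable lborel (\<lambda>x. f (fst x) (snd x))"
  \<comment> \<open>The cut-off confines \<open>q\<close> to \<open>[-T, T]\<close>, and then the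
    support of \<kappa>' confines \<open>p\<close> to within \<open>T * \<bar>b'\<bar> + h\<close>
    of \<open>a'\<close>.\<close>
  proof (rule integrable_bounded_support[where B="1 * (m * m)" and S="{-(\<bar>a'\<bar>+T*\<bar>b'\<bar>+h)..\<bar>a'\<bar>+T*\<bar>b'\<bar>+h}\<times>{-T..T}"])
    fix x :: "real \<times> real"
    show "\<bar>f (fst x) (snd x)\<bar> \<le> 1 * (m * m)"
      unfolding f_def abs_mult by (intro mult_mono bd) (auto simp: m0)
    assume x: "x \<notin> {-(\<bar>a'\<bar>+T*\<bar>b'\<bar>+h)..\<bar>a'\<bar>+T*\<bar>b'\<bar>+h}\<times>{-T..T}"
    show "f (fst x) (snd x) = 0"
    proof (cases "\<bar>snd x\<bar> > T")
      case True then show ?thesis by (simp add: f_def supp)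
    next
      case False
      then have "\<bar>fst x\<bar> > \<bar>a'\<bar>+T*\<bar>b'\<bar>+h" using x by (cases x) (auto simp: abs_le_iff)
      moreover have "\<bar>snd x * b'\<bar> \<le> T*\<bar>b'\<bar>" using False by (simp add: abs_mult mult_right_mono)
      ultimately have "\<bar>a' - fst x - snd x * b'\<bar> > h" by linarith
      then show ?thesis by (simp add: f_def supp)
    qed
  qed (auto simp: f_def bounded_Times simp flip: borel_prod)
  then show ?thesis by (simp add: f_def)
qed

text \<open>After the substitution \<open>z = a' - p - q b'\<close> the inner integral over \<open>q\<close> tests the mean-zero kernel \<open>\<kappa>\<close>
  against a Lipschitz function at scale \<open>h/d\<close>. Only \<open>\<bar>b - b'\<bar> \<ge> d/(4T)\<close> matters, since otherwise the two
  strips do not meet over the support of \<open>\<psi>\<close>.\<close>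

lemma kernel_correlation:
  fixes \<kappa> \<kappa>' \<psi> :: "real \<Rightarrow> real"
  assumes meas [measurable]: "\<kappa> \<in> borel_measurable borel" "\<kappa>' \<in> borel_measurable borel" "\<psi> \<in> borel_measurable borel"
    and bd: "\<And>z. \<bar>\<kappa> z\<bar> \<le> m" "\<And>z. \<bar>\<kappa>' z\<bar> \<le> m" "\<And>q. \<bar>\<psi> q\<bar> \<le> 1"
    and supp: "\<And>z. \<bar>z\<bar> > h \<Longrightarrow> \<kappa> z = 0" "\<And>z. \<bar>z\<bar> > h \<Longrightarrow> \<kappa>' z = 0" "\<And>q. \<bar>q\<bar> > T \<Longrightarrow> \<psi> q = 0"
    and lip: "\<And>x y. \<bar>\<psi> x - \<psi> y\<bar> \<le> \<bar>x - y\<bar>"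
    and mean: "(LINT z|lborel. \<kappa> z) = 0"
    and h: "h > 0" and T: "T \<ge> 1" 
    and d: "d = max \<bar>a - a'\<bar> \<bar>b - b'\<bar>"
  shows "\<bar>LINT x|lborel. \<psi> (snd x) * (\<kappa> (a - fst x - snd x * b) * \<kappa>' (a' - fst x - snd x * b'))\<bar>
     \<le> 64 * T\<^sup>2 * h * m\<^sup>2 * (if d \<le> h then 1 else (h/d)\<^sup>2)"
proof -
  have m0: "m \<ge> 0" using bd(1)[of 0] by linarith
  define A where "A = a - a'"
  define e where "e = b - b'"
  define f where "f = (\<lambda>p q. \<psi> q * (\<kappa> (a - p - q * b) * \<kappa>' (a' - p - q * b')))"
  define k where "k = (\<lambda>z q. \<psi> q * (\<kappa> (z + A - q * e) * \<kappa>' z))"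
  have i1: "integrable lborel (\<lambda>x. f (fst x) (snd x))"
    unfolding f_def by (rule integrable_kernel_product) (use assms in auto)
  have i2: "integrable (lborel \<Otimes>\<^sub>M lborel) (\<lambda>(z, q). k z q)"
    unfolding lborel_prod split_def
  proof (rule integrable_bounded_support[where B="1 * (m * m)" and S="{-h..h}\<times>{-T..T}"])
    fix x :: "real \<times> real"
    show "\<bar>k (fst x) (snd x)\<bar> \<le> 1 * (m * m)"
      unfolding k_def abs_mult by (intro mult_mono bd) (auto simp: m0)
    assume x: "x \<notin> {-h..h}\<times>{-T..T}"
    then have "\<bar>snd x\<bar> > T \<or> \<bar>fst x\<bar> > h" by (cases x) (auto simp: abs_le_iff)
    then show "k (fst x) (snd x) = 0" by (auto simp: k_def supp)
  qed (auto simp: k_def bounded_Times simp flip: borel_prod)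
  have "(LINT x|lborel. f (fst x) (snd x)) = (LINT q|lborel. LINT p|lborel. f p q)"
    using lborel_pair.integral_snd[of f] i1 by (simp add: lborel_prod split_def)
  also have "\<dots> = (LINT q|lborel. LINT z|lborel. k z q)"
  proof (rule Bochner_Integration.integral_cong[OF refl])
    fix q
    have "(LINT p|lborel. f p q) = \<bar>-1\<bar> *\<^sub>R (LINT z|lborel. f ((a' - q*b') + (-1) * z) q)"
      by (rule lborel_integral_real_affine) simp
    also have "\<dots> = (LINT z|lborel. k z q)"
      unfolding f_def k_def A_def e_def by (simp add: algebra_simps)
    finally show "(LINT p|lborel. f p q) = (LINT z|lborel. k z q)" .
  qed
  also have "\<dots> = (LINT z|lborel. LINT q|lborel. k z q)"
    by (rule lborel_pair.Fubini_integral[OF i2])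
  finally have eq: "(LINT x|lborel. f (fst x) (snd x)) = (LINT z|lborel. LINT q|lborel. k z q)" .
  define g where "g = (\<lambda>z. LINT q|lborel. \<psi> q * \<kappa> (z + A - q * e))"
  have g_meas [measurable]: "g \<in> borel_measurable borel" unfolding g_def by measurable
  have kg: "(LINT q|lborel. k z q) = \<kappa>' z * g z" for z
    unfolding k_def g_def 
    by (subst integral_mult_right_zero[symmetric]) (simp add: mult_ac)
  have outer: "\<bar>LINT z|lborel. LINT q|lborel. k z q\<bar> \<le> 2 * h * (m * G)"
    if G: "\<And>z. \<bar>z\<bar> \<le> h \<Longrightarrow> \<bar>g z\<bar> \<le> G" for G
  proof (unfold kg, rule integral_abs_le_support)
    have G0: "G \<ge> 0" using G[of 0] h by (auto intro: order_trans[OF abs_ge_zero])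
    show "\<bar>\<kappa>' z * g z\<bar> \<le> m * G" for z
    proof (cases "\<bar>z\<bar> \<le> h")
      case True
      then show ?thesis unfolding abs_mult by (intro mult_mono bd G) (auto simp: m0)
    qed (use supp(2)[of z] m0 G0 in auto)
  qed (use h supp in \<open>auto simp: mult.commute\<close>)
  \<comment> \<open>This serves for \<open>d < 4 * h\<close>: there the weight is at least 1/16,
    which the constant 64 absorbs.\<close>
  have triv: "\<bar>LINT z|lborel. LINT q|lborel. k z q\<bar> \<le> 4 * T * h * m\<^sup>2"
  proof -
    have "\<bar>g z\<bar> \<le> 2 * T * (1 * m)" for z
      unfolding g_def
    proof (rule integral_abs_le_support)
      show "\<bar>\<psi> x * \<kappa> (z + A - x * e)\<bar> \<le> 1 * m" for x
        unfolding abs_mult by (intro mult_mono bd) auto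
    qed (use T supp in auto)
    from outer[OF this] show ?thesis by (simp add: power2_eq_square mult_ac)
  qed
  have dd: "d = max \<bar>A\<bar> \<bar>e\<bar>" by (simp add: d A_def e_def)
  show ?thesis
  proof (cases "d < 4 * h")
    case True
    have "4 * T * h * m\<^sup>2 \<le> 64 * T\<^sup>2 * h * m\<^sup>2 * (1/16)"
      using T h mult_right_mono[of 1 T "m * m"] by (simp add: power2_eq_square)
    also have "\<dots> \<le> 64 * T\<^sup>2 * h * m\<^sup>2 * (if d \<le> h then 1 else (h/d)\<^sup>2)"
    proof (rule mult_left_mono)
      show "1/16 \<le> (if d \<le> h then 1 else (h/d)\<^sup>2)"
      proof (cases "d \<le> h")
        case False
        then have "1/4 \<le> h/d" using True h by (simp add: field_simps)
        then have "(1/4)\<^sup>2 \<le> (h/d)\<^sup>2" by (intro power_mono) auto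
        then show ?thesis using False by (simp add: power2_eq_square)
      qed simp
    qed (use T h in auto)
    finally show ?thesis using triv eq unfolding f_def by linarith
  next
    case False
    then have dh: "d \<ge> 4 * h" and d0: "d > 0" using h by auto
    have "\<bar>g z\<bar> \<le> 32 * T\<^sup>2 * h\<^sup>2 * m / d\<^sup>2" if z: "\<bar>z\<bar> \<le> h" for z
    proof (cases "\<bar>e\<bar> < d / (4 * T)")
      case True
      have "d / (4*T) \<le> d" using T d0 by (simp add: field_simps)
      then have Ad: "\<bar>A\<bar> = d" using dd True by linarith
      \<comment> \<open>Here \<open>\<bar>A\<bar> = d\<close>, while \<open>z\<close> and
        \<open>q * e\<close> are each at most \<open>d / 4\<close> in modulus, so the argument of
        \<kappa> leaves its support.\<close>
      have "\<psi> q * \<kappa> (z + A - q * e) = 0" for q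
      proof (cases "\<bar>q\<bar> > T")
        case False
        have "\<bar>q * e\<bar> \<le> T * (d / (4 * T))" unfolding abs_mult using False True T 
          by (intro mult_mono) auto
        also have "\<dots> = d/4" using T by simp
        finally have "\<bar>z + A - q * e\<bar> > h" using Ad z dh h by linarith
        then show ?thesis by (simp add: supp)
      qed (simp add: supp)
      then have "(\<lambda>q. \<psi> q * \<kappa> (z + A - q * e)) = (\<lambda>q. 0)" by blast
      then have "g z = 0" unfolding g_def by simp
      then show ?thesis using m0 by simp
    next
      case False
      then have eb: "\<bar>e\<bar> \<ge> d / (4 * T)" by simp
      moreover have "d / (4*T) > 0" using d0 T by simp
      ultimately have e0: "\<bar>e\<bar> > 0" by linarith
      have ik: "integrable lborel \<kappa>"
      proof (rule integrable_bounded_support[where S="{-h..h}" and B=m])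
        show "\<kappa> x = 0" if "x \<notin> {-h..h}" for x using that by (intro supp(1)) auto
      qed (use bd in auto)
      have ick: "integrable lborel (\<lambda>y. \<psi> ((z + A - y)/e) * \<kappa> y)"
      proof (rule integrable_bounded_support[where S="{-h..h}" and B="1 * m"])
        show "\<bar>\<psi> ((z + A - x)/e) * \<kappa> x\<bar> \<le> 1 * m" for x unfolding abs_mult by (intro mult_mono bd) auto
        show "\<psi> ((z + A - x)/e) * \<kappa> x = 0" if "x \<notin> {-h..h}" for x
        proof -
          have "\<bar>x\<bar> > h" using that by auto
          then show ?thesis by (simp add: supp)
        qed
      qed auto
      \<comment> \<open>The change of variable gives one factor \<open>1 / \<bar>e\<bar>\<close>.
        Subtracting the constant \<open>\<psi> ((z + A) / e)\<close>, which is free because \<kappa>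
        has mean zero, gives a second one through the Lipschitz bound.\<close>
      have "g z = \<bar>-1/e\<bar> *\<^sub>R (LINT y|lborel. \<psi> ((z+A)/e + (-1/e) * y) * \<kappa> (z + A - ((z+A)/e + (-1/e) * y) * e))"
        unfolding g_def using e0 by (intro lborel_integral_real_affine) auto
      also have "\<dots> = (1/\<bar>e\<bar>) * (LINT y|lborel. \<psi> ((z + A - y)/e) * \<kappa> y)"
      proof -
        have "(z+A)/e + (-1/e) * y = (z + A - y)/e" "z + A - (z + A - y)/e * e = y" for y
          using e0 by (simp_all add: field_simps)
        then show ?thesis by (simp only:) simp
      qed
      also have "(LINT y|lborel. \<psi> ((z + A - y)/e) * \<kappa> y) = 
          (LINT y|lborel. \<psi> ((z + A - y)/e) * \<kappa> y) - (LINT y|lborel. \<psi> ((z + A)/e) * \<kappa> y)"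
        by (simp add: mean)
      also have "\<dots> = (LINT y|lborel. (\<psi> ((z + A - y)/e) - \<psi> ((z + A)/e)) * \<kappa> y)"
        unfolding left_diff_distrib
        by (rule Bochner_Integration.integral_diff[symmetric]) (use ick ik in auto)
      finally have gz: "g z = (1/\<bar>e\<bar>) * (LINT y|lborel. (\<psi> ((z + A - y)/e) - \<psi> ((z + A)/e)) * \<kappa> y)" .
      have "\<bar>LINT y|lborel. (\<psi> ((z + A - y)/e) - \<psi> ((z + A)/e)) * \<kappa> y\<bar> \<le> 2 * h * ((h/\<bar>e\<bar>) * m)"
      proof (rule integral_abs_le_support)
        show "\<bar>(\<psi> ((z + A - y)/e) - \<psi> ((z + A)/e)) * \<kappa> y\<bar> \<le> (h/\<bar>e\<bar>) * m" for y
        proof (cases "\<bar>y\<bar> > h")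
          case False
          have "\<bar>\<psi> ((z + A - y)/e) - \<psi> ((z + A)/e)\<bar> \<le> \<bar>(z + A - y)/e - (z + A)/e\<bar>" by (rule lip)
          also have "\<dots> = \<bar>y\<bar> / \<bar>e\<bar>" by (simp flip: diff_divide_distrib add: abs_divide)
          also have "\<dots> \<le> h/\<bar>e\<bar>" using False by (simp add: divide_right_mono)
          finally show ?thesis unfolding abs_mult using h by (intro mult_mono bd) auto
        qed (use supp m0 h in auto)
      qed (use h supp in auto)
      then have "\<bar>g z\<bar> \<le> (1/\<bar>e\<bar>) * (2 * h * ((h/\<bar>e\<bar>) * m))"
        unfolding gz abs_mult by (intro mult_mono) auto
      also have "\<dots> = 2 * h\<^sup>2 * m * (1/\<bar>e\<bar>)\<^sup>2" by (simp add: power2_eq_square)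
      also have "\<dots> \<le> 2 * h\<^sup>2 * m * (4 * T/d)\<^sup>2"
      proof (intro mult_left_mono power_mono)
        show "1/\<bar>e\<bar> \<le> 4 * T/d" using eb e0 d0 T by (simp add: field_simps)
      qed (use m0 in auto)
      also have "\<dots> = 32 * T\<^sup>2 * h\<^sup>2 * m / d\<^sup>2" by (simp add: power_divide power_mult_distrib)
      finally show ?thesis .
    qed
    from outer[OF this] have "\<bar>LINT z|lborel. LINT q|lborel. k z q\<bar> \<le> 2 * h * (m * (32 * T\<^sup>2 * h\<^sup>2 * m / d\<^sup>2))" .
    also have "\<dots> = 64 * T\<^sup>2 * h * m\<^sup>2 * (h/d)\<^sup>2" by (simp add: power_divide power2_eq_square)
    finally show ?thesis using eq False h unfolding f_def by simp
  qed
qed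

section \<open>Finite Frostman systems\<close>

text \<open>Points are abstract and carry coordinate functions, so moving the origin to a vertex or
  exchanging the coordinates changes only \<open>u\<close> and \<open>v\<close>. Besides bounding
  coordinates, \<open>1 / L\<close> later serves as the lower bound for
  \<open>\<bar>v y\<bar>\<close> and for the determinants.\<close>

locale frostman_points =
  fixes X :: "'a set" and u v w :: "'a \<Rightarrow> real" and s C L \<delta> :: real
  assumes finite_X: "finite X"
    and w_nonneg: "\<And>x. x \<in> X \<Longrightarrow> 0 \<le> w x"
    and s_gt: "1 < s" and s_lt: "s < 2" and C_ge: "1 \<le> C" and L_ge: "1 \<le> L" and \<delta>_pos: "0 < \<delta>" and \<delta>_le: "\<delta> \<le> 1"
    and u_bd: "\<And>x. x \<in> X \<Longrightarrow> \<bar>u x\<bar> \<le> L" and v_bd: "\<And>x. x \<in> X \<Longrightarrow> \<bar>v x\<bar> \<le> L"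
    and frostman: "\<And>a b \<rho>. \<delta> \<le> \<rho> \<Longrightarrow> (\<Sum>x\<in>{x\<in>X. \<bar>u x - a\<bar> \<le> \<rho> \<and> \<bar>v x - b\<bar> \<le> \<rho>}. w x) \<le> C * \<rho> powr s"
begin

lemma subset_mass_le:
  assumes "\<delta> \<le> \<rho>" and "\<And>x. x \<in> X \<Longrightarrow> P x \<Longrightarrow> \<bar>u x - a\<bar> \<le> \<rho> \<and> \<bar>v x - b\<bar> \<le> \<rho>"
  shows "(\<Sum>x\<in>{x\<in>X. P x}. w x) \<le> C * \<rho> powr s"
proof -
  have "(\<Sum>x\<in>{x\<in>X. P x}. w x) \<le> (\<Sum>x\<in>{x\<in>X. \<bar>u x - a\<bar> \<le> \<rho> \<and> \<bar>v x - b\<bar> \<le> \<rho>}. w x)"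
    using assms(2) finite_X w_nonneg by (intro sum_mono2) auto
  then show ?thesis using frostman[OF assms(1), of a b] by linarith
qed

lemma mass_le: "(\<Sum>x\<in>X. w x) \<le> C * L\<^sup>2"
proof -
  have "(\<Sum>x\<in>{x\<in>X. True}. w x) \<le> C * L powr s"
    using L_ge \<delta>_le u_bd v_bd by (intro subset_mass_le[of _ _ 0 0]) auto
  also have "L powr s \<le> L powr 2" using L_ge s_lt by (intro powr_mono) auto
  finally show ?thesis using C_ge L_ge by (simp add: mult_left_mono)
qed

text \<open>Cutting the strip by \<open>v\<close> into slices of height \<open>r\<close> gives
  O(\<open>L / r\<close>) pieces, each inside a box of half-side \<open>(W + Q) * r\<close>. The
  exponent drops from \<open>s\<close> to \<open>s - 1\<close> because of the number of
  slices.\<close>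

lemma strip_mass_le:
  assumes r: "\<delta> \<le> r" "r \<le> 1" and q: "\<bar>q\<bar> \<le> Q" and W: "1 \<le> W"
  shows "(\<Sum>x\<in>{x\<in>X. \<bar>u x - p - q * v x\<bar> \<le> W * r}. w x) \<le> 4 * L * C * (W + Q)\<^sup>2 * r powr (s - 1)"
proof -
  have r0: "r > 0" using r \<delta>_pos by simp
  have Q0: "Q \<ge> 0" using q by linarith
  define S where "S = {x\<in>X. \<bar>u x - p - q * v x\<bar> \<le> W * r}"
  define \<rho> where "\<rho> = (W + Q) * r"
  have \<rho>: "\<delta> \<le> \<rho>"
  proof -
    have "1 * r \<le> \<rho>" unfolding \<rho>_def using W Q0 r0 by (intro mult_right_mono) auto
    then show ?thesis using r by simp
  qed
  define I where "I = {\<lfloor>-L/r\<rfloor>..\<lfloor>L/r\<rfloor>}"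
  have im: "(\<lambda>x. \<lfloor>v x / r\<rfloor>) ` S \<subseteq> I"
  proof
    fix k assume "k \<in> (\<lambda>x. \<lfloor>v x / r\<rfloor>) ` S"
    then obtain x where x: "x \<in> X" "k = \<lfloor>v x / r\<rfloor>" by (auto simp: S_def)
    have "-L \<le> v x" "v x \<le> L" using v_bd[OF x(1)] by auto
    then have "-L/r \<le> v x / r" "v x / r \<le> L / r" using r0 by (simp_all only: divide_right_mono less_imp_le)
    then show "k \<in> I" unfolding I_def x by (auto intro: floor_mono)
  qed
  have "sum w S = (\<Sum>k\<in>I. \<Sum>x\<in>{x\<in>S. \<lfloor>v x / r\<rfloor> = k}. w x)"
    by (rule sum.group[symmetric]) (use finite_X im in \<open>auto simp: S_def I_def\<close>)
  also have "\<dots> \<le> (\<Sum>k\<in>I. C * \<rho> powr s)"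
  proof (rule sum_mono)
    fix k assume "k \<in> I"
    have *: "{x\<in>S. \<lfloor>v x / r\<rfloor> = k} = {x\<in>X. \<bar>u x - p - q * v x\<bar> \<le> W * r \<and> \<lfloor>v x / r\<rfloor> = k}"
      by (auto simp: S_def)
    show "(\<Sum>x\<in>{x\<in>S. \<lfloor>v x / r\<rfloor> = k}. w x) \<le> C * \<rho> powr s"
      unfolding *
    proof (rule subset_mass_le[of _ _ "p + q * (k * r)" "k * r"])
      fix x assume "x \<in> X" and x: "\<bar>u x - p - q * v x\<bar> \<le> W * r \<and> \<lfloor>v x / r\<rfloor> = k"
      have "real_of_int k \<le> v x / r" "v x / r < real_of_int k + 1" using x by linarith+
      then have "k * r \<le> v x" "v x \<le> k * r + r" using r0 by (simp_all add: field_simps)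
      then have vk: "\<bar>v x - k * r\<bar> \<le> r" by simp
      have "\<bar>q * (v x - k * r)\<bar> \<le> Q * r" unfolding abs_mult using q vk Q0 by (intro mult_mono) auto
      moreover have "u x - (p + q * (k * r)) = (u x - p - q * v x) + q * (v x - k * r)" by (simp add: algebra_simps)
      ultimately have "\<bar>u x - (p + q * (k * r))\<bar> \<le> \<rho>" using x unfolding \<rho>_def distrib_right by linarith
      moreover have "r \<le> \<rho>" unfolding \<rho>_def using mult_right_mono[of 1 "W + Q" r] W Q0 r0 by simp
      ultimately show "\<bar>u x - (p + q * (k * r))\<bar> \<le> \<rho> \<and> \<bar>v x - k * r\<bar> \<le> \<rho>" using vk by linarith
    qed (rule \<rho>)
  qed
  also have "\<dots> = real (card I) * (C * \<rho> powr s)" by simp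
  also have "\<dots> \<le> (4 * L / r) * (C * \<rho> powr s)"
  proof (rule mult_right_mono)
    have Lr: "1 \<le> L / r" using r0 r L_ge by (simp add: field_simps)
    have "real (card I) = real_of_int (\<lfloor>L/r\<rfloor> - \<lfloor>-L/r\<rfloor> + 1)"
    proof -
      have "\<lfloor>-L/r\<rfloor> \<le> \<lfloor>L/r\<rfloor>" using Lr by (intro floor_mono) simp
      then show ?thesis unfolding I_def by simp
    qed
    also have "\<dots> \<le> L/r + L/r + 2" by simp linarith
    finally show "real (card I) \<le> 4 * L / r" using Lr by simp
  qed (use C_ge in auto)
  also have "\<dots> \<le> (4 * L / r) * (C * ((W + Q)\<^sup>2 * r powr s))"
  proof (intro mult_left_mono)
    have "\<rho> powr s = (W + Q) powr s * r powr s" unfolding \<rho>_def using W Q0 r0 by (simp add: powr_mult)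
    also have "(W + Q) powr s \<le> (W + Q) powr 2" using W Q0 s_lt by (intro powr_mono) auto
    finally show "\<rho> powr s \<le> (W + Q)\<^sup>2 * r powr s" using W Q0 by (simp add: mult_right_mono)
  qed (use C_ge L_ge r0 in auto)
  also have "\<dots> = 4 * L * C * (W + Q)\<^sup>2 * r powr (s - 1)"
    using r0 by (simp add: powr_diff)
  finally show ?thesis unfolding S_def .
qed

text \<open>The weight decays quadratically in the distance while the mass of a ball grows only with
  exponent \<open>s < 2\<close>, so dyadic annuli give a geometric series of ratio
  \<open>2 powr (s - 2)\<close>, and the ball of radius \<open>h\<close> dominates.\<close>

lemma kernel_sum_le:
  assumes h: "\<delta> \<le> h"
  defines "\<omega> \<equiv> \<lambda>d::real. if d \<le> h then 1 else (h/d)\<^sup>2"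
  shows "(\<Sum>y\<in>X. w y * \<omega> (max \<bar>a - u y\<bar> \<bar>b - v y\<bar>)) \<le> 4 * C / (1 - 2 powr (s - 2)) * h powr s"
proof -
  have h0: "h > 0" using h \<delta>_pos by simp
  define d where "d = (\<lambda>y. max \<bar>a - u y\<bar> \<bar>b - v y\<bar>)"
  obtain K where K: "\<And>y. y \<in> X \<Longrightarrow> d y \<le> 2 ^ K * h"
  proof -
    obtain M where M: "\<And>y. y \<in> X \<Longrightarrow> d y \<le> M"
    proof (rule that)
      show "d y \<le> (\<Sum>y\<in>X. d y)" if "y \<in> X" for y
        using finite_X that by (intro member_le_sum) (auto simp: d_def)
    qed
    obtain K where "M / h < 2 ^ K" using real_arch_pow[of 2 "M/h"] by auto
    then have "M \<le> 2 ^ K * h" using h0 by (simp add: field_simps)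
    then show ?thesis using M that by (meson order_trans)
  qed
  \<comment> \<open>One term suffices, that of the first \<open>k\<close> with
    \<open>d y \<le> 2^k * h\<close>. For \<open>k > 0\<close>, \<open>d y\<close> exceeds half of
    this bound, whence the factor 4.\<close>
  have pt: "\<omega> (d y) \<le> 4 * (\<Sum>k\<le>K. (1/4)^k * (if d y \<le> 2^k * h then 1 else 0))" (is "_ \<le> 4 * (\<Sum>k\<le>K. ?g k)") if y: "y \<in> X" for y
  proof -
    define k where "k = (LEAST k. d y \<le> 2^k * h)"
    have k: "d y \<le> 2^k * h" "k \<le> K" unfolding k_def 
      using K[OF y] LeastI[of "\<lambda>k. d y \<le> 2^k * h" K] Least_le[of "\<lambda>k. d y \<le> 2^k * h" K] by auto
    have "?g k \<le> (\<Sum>k\<le>K. ?g k)" using k by (intro member_le_sum) auto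
    moreover have "\<omega> (d y) \<le> 4 * (1/4)^k"
    proof (cases k)
      case 0
      then show ?thesis using k by (simp add: \<omega>_def)
    next
      case (Suc j)
      then have "\<not> d y \<le> 2^j * h" using not_less_Least[of j "\<lambda>k. d y \<le> 2^k * h"] by (simp add: k_def)
      then have j: "2^j * h < d y" by simp
      have "1 * h \<le> 2^j * h" using h0 by (intro mult_right_mono) auto
      then have dh: "h < d y" using j by simp
      have "h / d y \<le> 1/2^j" using j h0 dh by (simp add: field_simps)
      then have "(h / d y)\<^sup>2 \<le> (1/2^j)\<^sup>2" using dh h0 by (intro power_mono) auto
      also have "\<dots> = 4 * (1/4)^k" using Suc by (simp add: power_divide power_even_eq[symmetric] power_mult[symmetric] mult.commute[of j] power_mult)
      finally show ?thesis using dh by (simp add: \<omega>_def)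
    qed
    ultimately show ?thesis using k by simp
  qed
  define \<theta> where "\<theta> = 2 powr (s - 2)"
  have \<theta>: "0 < \<theta>" "\<theta> < 1" unfolding \<theta>_def using s_lt powr_less_mono[of "s-2" 0 2] by auto
  have "(\<Sum>y\<in>X. w y * \<omega> (d y)) \<le> (\<Sum>y\<in>X. w y * (4 * (\<Sum>k\<le>K. (1/4)^k * (if d y \<le> 2^k * h then 1 else 0))))"
    by (intro sum_mono mult_left_mono pt w_nonneg)
  also have "\<dots> = 4 * (\<Sum>k\<le>K. (1/4)^k * (\<Sum>y\<in>X. if d y \<le> 2^k * h then w y else 0))"
    unfolding sum_distrib_left by (subst sum.swap) (auto intro!: sum.cong)
  also have "\<dots> \<le> 4 * (\<Sum>k\<le>K. (1/4)^k * (C * (2^k * h) powr s))"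
  proof (intro mult_left_mono sum_mono)
    fix k
    have "(\<Sum>y\<in>X. if d y \<le> 2^k * h then w y else 0) = (\<Sum>y\<in>{y\<in>X. d y \<le> 2^k * h}. w y)"
      using finite_X by (simp add: sum.inter_filter)
    also have "\<dots> \<le> C * (2^k * h) powr s"
    proof (rule subset_mass_le[of _ _ a b])
      have "1 * h \<le> 2^k * h" using h0 by (intro mult_right_mono) auto
      then show "\<delta> \<le> 2^k * h" using h by simp
    qed (auto simp: d_def abs_minus_commute)
    finally show "(\<Sum>y\<in>X. if d y \<le> 2^k * h then w y else 0) \<le> C * (2^k * h) powr s" .
  qed auto
  also have "\<dots> = 4 * C * h powr s * (\<Sum>k\<le>K. \<theta>^k)"
  proof -
    have "(1/4)^k * (C * (2^k * h) powr s) = C * h powr s * \<theta>^k" for k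
    proof -
      have "(2^k * h) powr s = (2 powr s)^k * h powr s" using h0 
        by (simp add: powr_mult powr_powr powr_realpow[symmetric] powr_power mult.commute)
      moreover have "\<theta> = 2 powr s / 4" by (simp add: \<theta>_def powr_diff)
      then have "\<theta>^k = (2 powr s)^k / 4^k" by (simp only: power_divide)
      ultimately show ?thesis by (simp add: power_one_over)
    qed
    then show ?thesis by (simp only: sum_distrib_left mult.assoc)
  qed
  also have "\<dots> \<le> 4 * C * h powr s * (1 / (1 - \<theta>))"
  proof (intro mult_left_mono)
    have "(\<Sum>k\<le>K. \<theta>^k) \<le> (\<Sum>k. \<theta>^k)" using \<theta> by (intro sum_le_suminf summable_geometric) auto
    also have "\<dots> = 1 / (1 - \<theta>)" using \<theta> by (intro suminf_geometric) auto
    finally show "(\<Sum>k\<le>K. \<theta>^k) \<le> 1 / (1 - \<theta>)" .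
  qed (use C_ge in auto)
  finally show ?thesis by (simp add: \<theta>_def d_def mult_ac)
qed

end

section \<open>The X-ray transform across scales\<close>

text \<open>Half-open, with \<open>(p, q)\<close> as the lower left corner, so that a square is the
  disjoint union of four translates of its half and the indicators add up pointwise.\<close>

definition square :: "real \<Rightarrow> real \<Rightarrow> real \<Rightarrow> (real \<times> real) set" where
  "square r p q = {p..<p + r} \<times> {q..<q + r}"

lemma square_borel [measurable]: "square r p q \<in> sets borel"
  unfolding square_def borel_prod[symmetric] by measurable

lemma bounded_square: "bounded (square r p q)"
  unfolding square_def by (intro bounded_Times) (auto intro: bounded_subset[of "{_.._}"])

lemma integral_square: "r \<ge> 0 \<Longrightarrow> (LINT z|lborel. indicator (square r p q) z) = r\<^sup>2"
proof -
  assume r: "r \<ge> 0"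
  have "emeasure lborel (square r p q) = ennreal r * ennreal r"
    unfolding square_def lborel_prod[symmetric] using r
    by (subst lborel.emeasure_pair_measure_Times) auto
  then have "measure lborel (square r p q) = r\<^sup>2" using r
    by (simp add: measure_def ennreal_mult[symmetric] power2_eq_square)
  then show ?thesis by simp
qed

lemma integrable_square_mult:
  assumes "g \<in> borel_measurable borel" "\<And>z. z \<in> square r p q \<Longrightarrow> \<bar>g z\<bar> \<le> (B::real)"
  shows "integrable lborel (\<lambda>z. indicator (square r p q) z * g z)"
proof (rule integrable_bounded_support[where S="square r p q" and B="max B 0"])
  show "\<bar>indicator (square r p q) x * g x\<bar> \<le> max B 0" for x
    using assms(2)[of x] by (auto simp: indicator_def)
qed (use assms bounded_square in auto)

lemma integrable_square_const: "integrable lborel (\<lambda>z. indicator (square r p q) z * (c::real))"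
  by (rule integrable_square_mult[where B="\<bar>c\<bar>"]) auto

lemma integral_translation:
  fixes f :: "'a::euclidean_space \<Rightarrow> real"
  assumes [measurable]: "f \<in> borel_measurable borel"
  shows "(LINT z|lborel. f (c + z)) = (LINT z|lborel. f z)"
proof -
  have "(LINT z|lborel. f z) = (LINT z|distr lborel borel ((+) c). f z)" by (simp add: lborel_distr_plus)
  also have "\<dots> = (LINT z|lborel. f (c + z))" by (rule integral_distr) auto
  finally show ?thesis by simp
qed

lemma integral_interval_kernel:
  fixes c h k :: real
  assumes "h \<ge> 0"
  shows "(LINT z|lborel. (if \<bar>z - c\<bar> \<le> h then k else 0)) = 2 * h * k"
    and "integrable lborel (\<lambda>z. if \<bar>z - c\<bar> \<le> h then k else 0)"
proof -
  have *: "(\<lambda>z. if \<bar>z - c\<bar> \<le> h then k else 0) = (\<lambda>z. k * indicator {c-h..c+h} z)"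
    by (auto simp: fun_eq_iff indicator_def abs_le_iff)
  show "(LINT z|lborel. (if \<bar>z - c\<bar> \<le> h then k else 0)) = 2 * h * k"
    unfolding * using assms by simp
  show "integrable lborel (\<lambda>z. if \<bar>z - c\<bar> \<le> h then k else 0)"
    unfolding * by (intro integrable_mult_right integrable_real_indicator) (use assms in auto)
qed

text \<open>A Lipschitz substitute for the indicator of \<open>[-Q, Q]\<close>; a sharp cut-off in
  the slope would violate the Lipschitz condition of \<open>kernel_correlation\<close>.\<close>

definition tent :: "real \<Rightarrow> real \<Rightarrow> real" where
  "tent Q q = max 0 (min 1 (Q + 1 - \<bar>q\<bar>))"

lemma tent_measurable [measurable]: "tent Q \<in> borel_measurable borel"
  unfolding tent_def by measurable

lemma tent_props:
  shows "\<bar>tent Q q\<bar> \<le> 1" "0 \<le> tent Q q" "\<bar>q\<bar> > Q + 1 \<Longrightarrow> tent Q q = 0" "\<bar>q\<bar> \<le> Q \<Longrightarrow> tent Q q = 1"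
    "\<bar>tent Q x - tent Q y\<bar> \<le> \<bar>x - y\<bar>"
  unfolding tent_def by (auto simp: max_def min_def)

context frostman_points
begin

definition W where "W = L + 2"
text \<open>Slopes \<open>u y / v y\<close> are at most \<open>L\<^sup>2\<close> when
  \<open>\<bar>v y\<bar> \<ge> 1 / L\<close>; averaging over a square of side at most 1 adds at most
  1.\<close>

definition Q where "Q = L\<^sup>2 + 1"

text \<open>A line \<open>u = p + q v\<close> is represented by its parameters \<open>(p, q)\<close>. Moving them by less than \<open>r\<close> moves the line
  by at most \<open>(L + 1) r\<close> over \<open>\<bar>v\<bar> \<le> L\<close>, hence the choice of the half-width \<open>W r\<close>.\<close>

definition strip_density where
  "strip_density r p q = (\<Sum>x\<in>X. w x * (if \<bar>u x - p - q * v x\<bar> \<le> W * r then 1 / r else 0))"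

text \<open>The average makes the value at a single line an integral over a square of lines, which
  an L2 estimate on the space of lines can control.\<close>

definition smoothed_density where
  "smoothed_density r p q = 1 / r\<^sup>2 * (LINT z|lborel. indicator (square r p q) z * strip_density r (fst z) (snd z))"

definition strip_const where "strip_const = 4 * L * C * (W + Q)\<^sup>2"

lemma W_ge: "3 \<le> W" using L_ge by (simp add: W_def)
lemma Q_ge: "2 \<le> Q" using L_ge by (simp add: Q_def)
lemma strip_const_nonneg: "0 \<le> strip_const" using L_ge C_ge by (simp add: strip_const_def)

lemma strip_density_measurable [measurable]: "(\<lambda>z. strip_density r (fst z) (snd z)) \<in> borel_measurable (borel :: (real\<times>real) measure)"
  unfolding strip_density_def borel_prod[symmetric] by measurable

lemma strip_density_nonneg: "r > 0 \<Longrightarrow> 0 \<le> strip_density r p q"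
  unfolding strip_density_def using w_nonneg by (intro sum_nonneg) auto

lemma strip_density_eq: "strip_density r p q = (\<Sum>x\<in>{x\<in>X. \<bar>u x - p - q * v x\<bar> \<le> W * r}. w x) / r"
  unfolding strip_density_def sum_divide_distrib using finite_X by (simp add: sum.inter_filter) (auto intro!: sum.cong)

lemma strip_density_le:
  assumes "\<delta> \<le> r" "r \<le> 1" "\<bar>q\<bar> \<le> Q"
  shows "strip_density r p q \<le> strip_const * r powr (s - 2)"
proof -
  have r: "r > 0" using assms \<delta>_pos by linarith
  have "(\<Sum>x\<in>{x\<in>X. \<bar>u x - p - q * v x\<bar> \<le> W * r}. w x) / r \<le> strip_const * r powr (s - 1) / r"
    unfolding strip_const_def using r assms W_ge by (intro divide_right_mono strip_mass_le) auto
  also have "\<dots> = strip_const * r powr (s - 2)" using r by (simp add: powr_diff power2_eq_square)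
  finally show ?thesis unfolding strip_density_eq .
qed

lemma square_snd_le:
  assumes "r \<le> 1" "\<bar>q\<bar> \<le> L\<^sup>2" "z \<in> square r p q"
  shows "\<bar>snd z\<bar> \<le> Q"
  using assms by (auto simp: square_def Q_def)

lemma strip_density_square_integrable:
  assumes "\<delta> \<le> r" "r \<le> 1" "\<bar>q\<bar> \<le> L\<^sup>2" "r' \<le> 1"
  shows "integrable lborel (\<lambda>z. indicator (square r' p q) z * strip_density r (fst z) (snd z))"
proof (rule integrable_square_mult)
  fix z assume "z \<in> square r' p q"
  then show "\<bar>strip_density r (fst z) (snd z)\<bar> \<le> strip_const * r powr (s - 2)"
    using strip_density_le[OF assms(1,2) square_snd_le[OF assms(4,3)]] strip_density_nonneg[of r] \<delta>_pos assms by auto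
qed simp

lemma smoothed_density_bounds:
  assumes "\<delta> \<le> r" "r \<le> 1" "\<bar>q\<bar> \<le> L\<^sup>2"
  shows "0 \<le> smoothed_density r p q" "smoothed_density r p q \<le> strip_const * r powr (s - 2)"
proof -
  have r: "r > 0" using assms \<delta>_pos by linarith
  show "0 \<le> smoothed_density r p q" unfolding smoothed_density_def using r strip_density_nonneg[of r] 
    by (intro mult_nonneg_nonneg Bochner_Integration.integral_nonneg) auto
  have "(LINT z|lborel. indicator (square r p q) z * strip_density r (fst z) (snd z)) 
     \<le> (LINT z|lborel. indicator (square r p q) z * (strip_const * r powr (s - 2)))"
  proof (rule integral_mono)
    show "indicator (square r p q) z * strip_density r (fst z) (snd z) \<le> indicator (square r p q) z * (strip_const * r powr (s - 2))" for z
      using strip_density_le[OF assms(1,2)] square_snd_le[OF assms(2,3), of z p] by (auto simp: indicator_def)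
  qed (use assms strip_density_square_integrable integrable_square_const in blast)+
  also have "\<dots> = r\<^sup>2 * (strip_const * r powr (s - 2))" using r integral_square[of r p q] by simp
  finally show "smoothed_density r p q \<le> strip_const * r powr (s - 2)" unfolding smoothed_density_def using r by (simp add: field_simps)
qed

text \<open>Together with \<open>smoothed_density_pos_witness\<close> this compares the average with
  genuine strips: mass in the strip of half-width \<open>r\<close> forces density, and positive
  density forces a point in the strip of half-width \<open>2 * W * r\<close>.\<close>

lemma smoothed_density_lower:
  assumes "\<delta> \<le> r" "r \<le> 1" "\<bar>q\<bar> \<le> L\<^sup>2"
  shows "(\<Sum>x\<in>{x\<in>X. \<bar>u x - p - q * v x\<bar> \<le> r}. w x) / r \<le> smoothed_density r p q" (is "?S / r \<le> _")
proof -
  have r: "r > 0" using assms \<delta>_pos by linarith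
  have "r\<^sup>2 * (?S / r) = (LINT z|lborel. indicator (square r p q) z * (?S / r))" using r integral_square[of r p q] by simp
  also have "\<dots> \<le> (LINT z|lborel. indicator (square r p q) z * strip_density r (fst z) (snd z))"
  proof (rule integral_mono)
    fix z
    have "?S / r \<le> strip_density r (fst z) (snd z)" if z: "z \<in> square r p q"
      unfolding strip_density_eq
    proof (intro divide_right_mono sum_mono2)
      show "{x \<in> X. \<bar>u x - p - q * v x\<bar> \<le> r} \<subseteq> {x \<in> X. \<bar>u x - fst z - snd z * v x\<bar> \<le> W * r}"
      proof safe
        fix x assume x: "x \<in> X" "\<bar>u x - p - q * v x\<bar> \<le> r"
        have "\<bar>(snd z - q) * v x\<bar> \<le> r * L" unfolding abs_mult
          using z v_bd[OF x(1)] r by (intro mult_mono) (auto simp: square_def)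
        moreover have "\<bar>fst z - p\<bar> \<le> r" using z by (auto simp: square_def)
        moreover have "u x - fst z - snd z * v x = (u x - p - q * v x) - (fst z - p) - (snd z - q) * v x"
          by (simp add: algebra_simps)
        ultimately show "\<bar>u x - fst z - snd z * v x\<bar> \<le> W * r" using x(2) unfolding W_def
          by (simp add: algebra_simps)
      qed
    qed (use finite_X w_nonneg r in auto)
    then show "indicator (square r p q) z * (?S / r) \<le> indicator (square r p q) z * strip_density r (fst z) (snd z)"
      by (auto simp: indicator_def)
  qed (use assms strip_density_square_integrable integrable_square_const in blast)+
  finally have "r\<^sup>2 * (?S / r) \<le> r\<^sup>2 * smoothed_density r p q" unfolding smoothed_density_def using r by simp
  moreover have "0 < r\<^sup>2" using r by simp
  ultimately show ?thesis using mult_le_cancel_left_pos by blast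
qed

lemma smoothed_density_pos_witness:
  assumes "r > 0" "smoothed_density r p q > 0"
  shows "\<exists>x\<in>X. \<bar>u x - p - q * v x\<bar> \<le> 2 * W * r"
proof (rule ccontr)
  assume no: "\<not> ?thesis"
  have "strip_density r (fst z) (snd z) = 0" if z: "z \<in> square r p q" for z
  proof -
    have "\<not> \<bar>u x - fst z - snd z * v x\<bar> \<le> W * r" if x: "x \<in> X" for x
    proof -
      have "\<bar>(snd z - q) * v x\<bar> \<le> r * L" unfolding abs_mult
        using z v_bd[OF x(1)] assms by (intro mult_mono) (auto simp: square_def)
      moreover have "\<bar>fst z - p\<bar> \<le> r" using z by (auto simp: square_def)
      moreover have "u x - fst z - snd z * v x = (u x - p - q * v x) - (fst z - p) - (snd z - q) * v x"
        by (simp add: algebra_simps)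
      moreover have "\<bar>u x - p - q * v x\<bar> > 2 * (W * r)" using no x by auto
      moreover have "W * r = r * L + 2 * r" by (simp add: W_def algebra_simps)
      ultimately show ?thesis using assms(1) by linarith
    qed
    then show ?thesis unfolding strip_density_def by (intro sum.neutral) auto
  qed
  then have "(\<lambda>z. indicator (square r p q) z * strip_density r (fst z) (snd z)) = (\<lambda>z. 0)"
    by (auto simp: fun_eq_iff indicator_def)
  then show False using assms(2) unfolding smoothed_density_def by simp
qed

text \<open>The four translates turn the average over a square of side \<open>r\<close> into one over a square of side \<open>r/2\<close>, so
  both scales are averaged over the same small square.\<close>

definition scale_difference where
  "scale_difference r p q = strip_density (r/2) p q - (1/4) * (strip_density r p q + strip_density r (p + r/2) q + strip_density r p (q + r/2) + strip_density r (p + r/2) (q + r/2))"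

lemma scale_difference_measurable [measurable]: "(\<lambda>z. scale_difference r (fst z) (snd z)) \<in> borel_measurable (borel :: (real\<times>real) measure)"
  unfolding scale_difference_def strip_density_def borel_prod[symmetric] by measurable

text \<open>A crude bound that degenerates with \<open>r\<close>; it only secures
  integrability.\<close>

lemma scale_difference_bounded: "\<exists>B. \<forall>p q. \<bar>scale_difference r p q\<bar> \<le> B"
proof -
  define S where "S = (\<lambda>r. \<Sum>x\<in>X. w x * \<bar>1 / r\<bar>)"
  have Yb: "\<bar>strip_density r p q\<bar> \<le> S r" for r p q
    unfolding strip_density_def S_def using w_nonneg by (intro order_trans[OF sum_abs] sum_mono) (auto simp: abs_mult)
  have "\<bar>scale_difference r p q\<bar> \<le> S (r/2) + S r" for p q
  proof -
    have "\<bar>a - (1/4) * (b + c + d + e)\<bar> \<le> k + l"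
      if "\<bar>a\<bar> \<le> k" "\<bar>b\<bar> \<le> l" "\<bar>c\<bar> \<le> l" "\<bar>d\<bar> \<le> l" "\<bar>e\<bar> \<le> l" for a b c d e k l :: real
    proof -
      have "\<bar>b + c + d + e\<bar> \<le> 4 * l" using that by linarith
      then have "\<bar>(1/4) * (b + c + d + e)\<bar> \<le> l" by (simp add: abs_mult)
      then show ?thesis using that(1) by linarith
    qed
    then show ?thesis unfolding scale_difference_def by (simp only: Yb)
  qed
  then show ?thesis by blast
qed

lemma smoothed_density_diff:
  assumes "\<delta> \<le> r/2" "r \<le> 1" "\<bar>q\<bar> \<le> L\<^sup>2"
  shows "smoothed_density (r/2) p q - smoothed_density r p q = 4 / r\<^sup>2 * (LINT z|lborel. indicator (square (r/2) p q) z * scale_difference r (fst z) (snd z))"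
proof -
  have r: "r > 0" using assms \<delta>_pos by linarith
  define I where "I = (\<lambda>a b. (LINT z|lborel. indicator (square (r/2) p q) z * strip_density r (fst z + a) (snd z + b)))"
  have Yb: "\<bar>strip_density r p q\<bar> \<le> (\<Sum>x\<in>X. w x * \<bar>1 / r\<bar>)" for r p q
    unfolding strip_density_def using w_nonneg by (intro order_trans[OF sum_abs] sum_mono) (auto simp: abs_mult)
  have Ym: "(\<lambda>z. strip_density r (fst z + a) (snd z + b)) \<in> borel_measurable (borel :: (real\<times>real) measure)" for a b r
    unfolding strip_density_def borel_prod[symmetric] by measurable
  have int: "integrable lborel (\<lambda>z. indicator (square r' p' q') z * strip_density r (fst z + a) (snd z + b))" for r' p' q' a b r
    by (rule integrable_square_mult[OF Ym Yb])
  have tr: "(LINT z|lborel. indicator (square (r/2) (p+a) (q+b)) z * strip_density r (fst z) (snd z)) = I a b" for a b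
  proof -
    have [measurable]: "(\<lambda>z. indicator (square (r/2) (p+a) (q+b)) z * strip_density r (fst z) (snd z)) \<in> borel_measurable borel"
      by measurable
    have "(LINT z|lborel. indicator (square (r/2) (p+a) (q+b)) z * strip_density r (fst z) (snd z)) =
      (LINT z|lborel. indicator (square (r/2) (p+a) (q+b)) ((a,b) + z) * strip_density r (fst ((a,b)+z)) (snd ((a,b)+z)))"
      by (rule integral_translation[symmetric]) simp
    also have "\<dots> = I a b" unfolding I_def
      by (intro Bochner_Integration.integral_cong) (auto simp: indicator_def square_def add_ac)
    finally show ?thesis .
  qed
  have split: "indicator (square r p q) z = indicator (square (r/2) (p+0) (q+0)) z + indicator (square (r/2) (p+r/2) (q+0)) z
     + indicator (square (r/2) (p+0) (q+r/2)) z + (indicator (square (r/2) (p+r/2) (q+r/2)) z :: real)" for z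
    using r by (cases z) (auto simp: indicator_def square_def)
  have "(LINT z|lborel. indicator (square r p q) z * strip_density r (fst z) (snd z)) = I 0 0 + I (r/2) 0 + I 0 (r/2) + I (r/2) (r/2)"
    unfolding split distrib_right tr[symmetric] using int[where a=0 and b=0]
    by simp
  moreover have "(LINT z|lborel. indicator (square (r/2) p q) z * scale_difference r (fst z) (snd z)) = 
     (LINT z|lborel. indicator (square (r/2) p q) z * strip_density (r/2) (fst z) (snd z)) - (1/4) * (I 0 0 + I (r/2) 0 + I 0 (r/2) + I (r/2) (r/2))"
  proof -
    have "(\<lambda>z. indicator (square (r/2) p q) z * scale_difference r (fst z) (snd z)) = 
      (\<lambda>z. indicator (square (r/2) p q) z * strip_density (r/2) (fst z + 0) (snd z + 0) - (1/4) * 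
      (indicator (square (r/2) p q) z * strip_density r (fst z + 0) (snd z + 0) + indicator (square (r/2) p q) z * strip_density r (fst z + r/2) (snd z + 0)
      + indicator (square (r/2) p q) z * strip_density r (fst z + 0) (snd z + r/2) + indicator (square (r/2) p q) z * strip_density r (fst z + r/2) (snd z + r/2)))"
      unfolding scale_difference_def by (auto simp: algebra_simps)
    then show ?thesis unfolding I_def
      using int[of "r/2" p q r] int[of "r/2" p q "r/2" 0 0]
      by (simp del: add_0_right)
  qed
  ultimately show ?thesis unfolding smoothed_density_def using r by (simp add: field_simps power2_eq_square)
qed

end

lemma integral_square_cauchy_schwarz:
  fixes g :: "real \<times> real \<Rightarrow> real"
  assumes g [measurable]: "g \<in> borel_measurable borel" and B: "\<And>z. \<bar>g z\<bar> \<le> B" and r: "r > 0"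
  shows "(LINT z|lborel. indicator (square r p q) z * g z)\<^sup>2 \<le> r\<^sup>2 * (LINT z|lborel. indicator (square r p q) z * (g z)\<^sup>2)"
proof -
  define I where "I = (LINT z|lborel. indicator (square r p q) z * g z)"
  \<comment> \<open>\<open>c\<close> is the mean of \<open>g\<close> over the square; the inequality
    says that the variance is nonnegative.\<close>
  define c where "c = I / r\<^sup>2"
  have B2: "\<bar>(g z)\<^sup>2\<bar> \<le> B\<^sup>2" for z using power_mono[OF B, of z 2] by simp
  have i1: "integrable lborel (\<lambda>z. indicator (square r p q) z * g z)"
    by (rule integrable_square_mult[OF g B])
  have i2: "integrable lborel (\<lambda>z. indicator (square r p q) z * (g z)\<^sup>2)"
    by (rule integrable_square_mult[OF _ B2]) auto
  have i0: "integrable lborel (\<lambda>z. indicator (square r p q) z * c\<^sup>2)" by (rule integrable_square_const)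
  have "0 \<le> (LINT z|lborel. indicator (square r p q) z * (g z - c)\<^sup>2)"
    by (intro Bochner_Integration.integral_nonneg) auto
  also have "\<dots> = (LINT z|lborel. indicator (square r p q) z * (g z)\<^sup>2 - (2 * c) * (indicator (square r p q) z * g z)
      + indicator (square r p q) z * c\<^sup>2)"
    by (intro Bochner_Integration.integral_cong) (auto simp: power2_eq_square algebra_simps)
  also have "\<dots> = (LINT z|lborel. indicator (square r p q) z * (g z)\<^sup>2) - 2 * c * I + r\<^sup>2 * c\<^sup>2"
    using i0 i1 i2 integral_square[of r p q] r unfolding I_def by simp
  finally have "0 \<le> r\<^sup>2 * ((LINT z|lborel. indicator (square r p q) z * (g z)\<^sup>2) - 2 * c * I + r\<^sup>2 * c\<^sup>2)"
    using r by (intro mult_nonneg_nonneg) auto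
  also have "\<dots> = r\<^sup>2 * (LINT z|lborel. indicator (square r p q) z * (g z)\<^sup>2) - I\<^sup>2"
    unfolding c_def using r by (simp add: field_simps power2_eq_square)
  finally show ?thesis unfolding I_def by simp
qed

section \<open>Energy of the difference between two scales\<close>

context frostman_points
begin

text \<open>Moving \<open>q\<close> by \<open>r/2\<close> shifts the argument
  \<open>u x - p - q * v x\<close> by \<open>r/2 * v x\<close>, so the kernel depends on the point
  through \<open>v x\<close>. Writing \<open>z - 0\<close> gives all five terms the shape of
  \<open>integral_interval_kernel\<close>.\<close>

definition difference_kernel where
  "difference_kernel r x z = (if \<bar>z - 0\<bar> \<le> W * (r/2) then 1 / (r/2) else 0)
     - (1/4) * ((if \<bar>z - 0\<bar> \<le> W * r then 1 / r else 0) + (if \<bar>z - r/2\<bar> \<le> W * r then 1 / r else 0)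
     + (if \<bar>z - r/2 * v x\<bar> \<le> W * r then 1 / r else 0) + (if \<bar>z - (r/2 + r/2 * v x)\<bar> \<le> W * r then 1 / r else 0))"

lemma difference_kernel_measurable [measurable]: "difference_kernel r x \<in> borel_measurable borel"
  unfolding difference_kernel_def by measurable

lemma scale_difference_eq: "scale_difference r p q = (\<Sum>x\<in>X. w x * difference_kernel r x (u x - p - q * v x))"
  unfolding scale_difference_def strip_density_def difference_kernel_def
  by (simp add: sum_subtractf sum.distrib sum_distrib_left algebra_simps)

lemma difference_kernel_bound:
  assumes "r > 0" shows "\<bar>difference_kernel r x z\<bar> \<le> 2 / r"
proof -
  have *: "\<bar>a - (1/4) * (b + c + d + e)\<bar> \<le> 2 * k"
    if "0 \<le> a" "a \<le> 2 * k" "0 \<le> b" "b \<le> k" "0 \<le> c" "c \<le> k" "0 \<le> d" "d \<le> k" "0 \<le> e" "e \<le> k" for a b c d e k :: real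
  proof -
    have "0 \<le> (1/4) * (b + c + d + e)" "b + c + d + e \<le> 4 * k" using that by auto
    then have "(1/4) * (b + c + d + e) \<le> k" by simp
    then show ?thesis using \<open>0 \<le> (1/4) * (b + c + d + e)\<close> that by linarith
  qed
  have "\<bar>difference_kernel r x z\<bar> \<le> 2 * (1/r)" unfolding difference_kernel_def by (rule *) (use assms in auto)
  then show ?thesis by simp
qed

lemma difference_kernel_support:
  assumes "r > 0" "x \<in> X" "\<bar>z\<bar> > 2 * W * r" shows "difference_kernel r x z = 0"
proof -
  have "\<bar>r/2 * v x\<bar> \<le> r/2 * L" unfolding abs_mult using v_bd[OF assms(2)] assms(1) by (intro mult_mono) auto
  moreover have "2 * W * r = W * r + r * L + 2 * r" "W * (r/2) = W * r / 2" by (simp_all add: W_def algebra_simps)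
  moreover have "0 \<le> W * r" "0 \<le> r * L" using W_ge L_ge assms(1) by auto
  ultimately have "\<not> \<bar>z - 0\<bar> \<le> W * (r/2)" "\<not> \<bar>z - 0\<bar> \<le> W * r" "\<not> \<bar>z - r/2\<bar> \<le> W * r" 
    "\<not> \<bar>z - r/2 * v x\<bar> \<le> W * r" "\<not> \<bar>z - (r/2 + r/2 * v x)\<bar> \<le> W * r"
    using assms(1,3) by linarith+
  then show ?thesis unfolding difference_kernel_def by simp
qed

text \<open>Every interval term is normalised to integral \<open>2 * W\<close> whatever its centre
  and scale, so the fine term cancels against the average of the four coarse ones.\<close>

lemma difference_kernel_mean:
  assumes "r > 0" shows "(LINT z|lborel. difference_kernel r x z) = 0"
proof -
  have W: "W * (r/2) \<ge> 0" "W * r \<ge> 0" using W_ge assms by auto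
  note i = integral_interval_kernel[OF W(1)] integral_interval_kernel[OF W(2)]
  show ?thesis unfolding difference_kernel_def using assms
    by (simp only: i Bochner_Integration.integral_diff Bochner_Integration.integral_add
        Bochner_Integration.integral_mult_right_zero Bochner_Integration.integrable_add 
        Bochner_Integration.integrable_mult_right) (simp add: field_simps)
qed

text \<open>512 comes from \<open>64 * h * (2/r)\<^sup>2\<close> with \<open>h = 2 * W * r\<close>,
  which leaves \<open>512 * W / r\<close>; the last factor bounds
  \<open>(2 * W) powr s\<close>.\<close>

definition energy_const where
  "energy_const = 512 * (Q + 1)\<^sup>2 * W * (C * L\<^sup>2) * (4 * C / (1 - 2 powr (s - 2))) * (4 * W\<^sup>2)"

lemma theta_lt: "2 powr (s - 2) < (1::real)"
  using s_lt powr_less_mono[of "s-2" 0 2] by auto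

lemma energy_const_nonneg: "0 \<le> energy_const"
  unfolding energy_const_def using W_ge Q_ge C_ge theta_lt L_ge by (intro mult_nonneg_nonneg divide_nonneg_nonneg) auto

text \<open>Expanding the square gives a double sum of kernel correlations. The inner sum is of
  order \<open>r powr s\<close> by \<open>kernel_sum_le\<close>, the outer one is the total mass,
  and the kernels contribute \<open>1 / r\<close>.\<close>

lemma scale_difference_energy:
  assumes r: "\<delta> \<le> r"
  shows "(LINT z|lborel. tent Q (snd z) * (scale_difference r (fst z) (snd z))\<^sup>2) \<le> energy_const * r powr (s - 1)"
proof -
  have r0: "r > 0" using r \<delta>_pos by linarith
  define h where "h = 2 * W * r"
  define T where "T = Q + 1"
  have h0: "h > 0" using W_ge r0 by (simp add: h_def)
  have hd: "\<delta> \<le> h" unfolding h_def using mult_right_mono[of 1 "2*W" r] W_ge r r0 by linarith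
  have T1: "1 \<le> T" using Q_ge by (simp add: T_def)
  define f where "f = (\<lambda>x y z. tent Q (snd z) * (difference_kernel r x (u x - fst z - snd z * v x) * difference_kernel r y (u y - fst z - snd z * v y)))"
  have int: "integrable lborel (f x y)" if "y \<in> X" for x y
    unfolding f_def 
    by (rule integrable_kernel_product[where m="2/r" and h=h and T=T]) 
       (use that difference_kernel_bound[OF r0] difference_kernel_support[OF r0] tent_props in \<open>auto simp: h_def T_def\<close>)
  have eq: "tent Q (snd z) * (scale_difference r (fst z) (snd z))\<^sup>2 = (\<Sum>x\<in>X. \<Sum>y\<in>X. w x * w y * f x y z)" for z
    unfolding scale_difference_eq power2_eq_square sum_product
    unfolding f_def sum_distrib_left by (intro sum.cong refl) (simp add: mult_ac)
  define \<omega> where "\<omega> = (\<lambda>d::real. if d \<le> h then 1 else (h/d)\<^sup>2)"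
  have "(LINT z|lborel. tent Q (snd z) * (scale_difference r (fst z) (snd z))\<^sup>2) = (\<Sum>x\<in>X. \<Sum>y\<in>X. w x * w y * (LINT z|lborel. f x y z))"
    unfolding eq using int by (subst Bochner_Integration.integral_sum, simp)+ simp
  also have "\<dots> \<le> (\<Sum>x\<in>X. \<Sum>y\<in>X. w x * w y * (64 * T\<^sup>2 * h * (2/r)\<^sup>2 * \<omega> (max \<bar>u x - u y\<bar> \<bar>v x - v y\<bar>)))"
  proof (intro sum_mono mult_left_mono)
    fix x y assume xy: "x \<in> X" "y \<in> X"
    have "\<bar>LINT z|lborel. f x y z\<bar> \<le> 64 * T\<^sup>2 * h * (2/r)\<^sup>2 * \<omega> (max \<bar>u x - u y\<bar> \<bar>v x - v y\<bar>)"
      unfolding f_def \<omega>_def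
      by (rule kernel_correlation)
         (use xy difference_kernel_bound[OF r0] difference_kernel_support[OF r0] tent_props difference_kernel_mean[OF r0] h0 T1 in \<open>auto simp: h_def T_def\<close>)
    then show "(LINT z|lborel. f x y z) \<le> 64 * T\<^sup>2 * h * (2/r)\<^sup>2 * \<omega> (max \<bar>u x - u y\<bar> \<bar>v x - v y\<bar>)" by linarith
  qed (use w_nonneg in auto)
  also have "\<dots> = 64 * T\<^sup>2 * h * (2/r)\<^sup>2 * (\<Sum>x\<in>X. w x * (\<Sum>y\<in>X. w y * \<omega> (max \<bar>u x - u y\<bar> \<bar>v x - v y\<bar>)))"
    unfolding sum_distrib_left by (simp only: mult_ac)
  also have "\<dots> \<le> 64 * T\<^sup>2 * h * (2/r)\<^sup>2 * (\<Sum>x\<in>X. w x * (4 * C / (1 - 2 powr (s - 2)) * h powr s))"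
    unfolding \<omega>_def using w_nonneg h0 T1 by (intro mult_left_mono sum_mono kernel_sum_le hd) auto
  also have "\<dots> = 64 * T\<^sup>2 * h * (2/r)\<^sup>2 * ((\<Sum>x\<in>X. w x) * (4 * C / (1 - 2 powr (s - 2)) * h powr s))"
    by (simp only: sum_distrib_right)
  also have "\<dots> \<le> 64 * T\<^sup>2 * h * (2/r)\<^sup>2 * ((C * L\<^sup>2) * (4 * C / (1 - 2 powr (s - 2)) * (4 * W\<^sup>2 * r powr s)))"
  proof (intro mult_left_mono mult_mono mass_le)
    have "h powr s = (2 * W) powr s * r powr s" unfolding h_def using W_ge r0 by (simp add: powr_mult)
    also have "(2 * W) powr s \<le> (2 * W) powr 2" using W_ge s_lt by (intro powr_mono) auto
    finally show "h powr s \<le> 4 * W\<^sup>2 * r powr s" using W_ge by (simp add: mult_right_mono power_mult_distrib)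
  qed (use C_ge L_ge theta_lt h0 in \<open>auto intro!: mult_nonneg_nonneg divide_nonneg_nonneg\<close>)
  also have "\<dots> = energy_const * r powr (s - 1)"
    unfolding energy_const_def h_def T_def using r0 by (simp add: powr_diff power2_eq_square mult_ac)
  finally show ?thesis .
qed

section \<open>Restriction to the lines attached to the points\<close>

lemma slope_le:
  assumes "y \<in> X" "1 / L \<le> \<bar>v y\<bar>" shows "\<bar>u y / v y\<bar> \<le> L\<^sup>2"
proof -
  have L0: "L > 0" using L_ge by simp
  have "0 < 1 / L" using L0 by simp
  then have "0 < \<bar>v y\<bar>" using assms(2) by linarith
  then have "1 / \<bar>v y\<bar> \<le> L" using assms(2) L0 by (simp add: field_simps)
  then have "\<bar>u y\<bar> * (1 / \<bar>v y\<bar>) \<le> L * L" using u_bd[OF assms(1)] L0 by (intro mult_mono) auto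
  then show ?thesis by (simp add: power2_eq_square)
qed

text \<open>For \<open>t\<close> and \<open>v\<close> bounded away from 0, the map from
  \<open>y\<close> to \<open>(t / v y, u y / v y)\<close> has an inverse with Lipschitz constant
  polynomial in \<open>L\<close>. Points whose squares contain a common \<open>z\<close> therefore
  lie in one box of half-side \<open>2 * L^5 * r\<close>, and the parameters inherit the dimension
  \<open>s\<close>.\<close>

lemma line_cell_mass:
  assumes t: "1 / L \<le> \<bar>t\<bar>" and B: "B \<subseteq> X" "\<And>y. y \<in> B \<Longrightarrow> 1 / L \<le> \<bar>v y\<bar>" and r: "\<delta> \<le> r"
  shows "(\<Sum>y\<in>B. w y * indicator (square r (t / v y) (u y / v y)) z) \<le> 4 * C * L^10 * r powr s"
proof -
  have L0: "L > 0" using L_ge by simp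
  have r0: "r > 0" using r \<delta>_pos by simp
  define S where "S = {y\<in>X. y \<in> B \<and> z \<in> square r (t / v y) (u y / v y)}"
  have "(\<Sum>y\<in>B. w y * indicator (square r (t / v y) (u y / v y)) z) = sum w S"
    unfolding S_def using B(1) finite_X by (intro sum.mono_neutral_cong_right[symmetric] sum.mono_neutral_cong_right) (auto simp: indicator_def intro: finite_subset)
  also have "\<dots> \<le> C * (2 * L^5 * r) powr s"
  proof (cases "S = {}")
    case True
    then show ?thesis using C_ge by simp
  next
    case False
    then obtain y0 where y0: "y0 \<in> X" "y0 \<in> B" "z \<in> square r (t / v y0) (u y0 / v y0)" by (auto simp: S_def)
    show ?thesis unfolding S_def
    proof (rule subset_mass_le[of _ _ "u y0" "v y0"])
      show "\<delta> \<le> 2 * L^5 * r" using mult_right_mono[of 1 "2 * L^5" r] one_le_power[OF L_ge, of 5] r r0 by linarith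
      fix y assume y: "y \<in> X" "y \<in> B \<and> z \<in> square r (t / v y) (u y / v y)"
      have nz: "v y \<noteq> 0" "v y0 \<noteq> 0" "t \<noteq> 0" using B(2) y y0 t L0 by force+
      have dp: "\<bar>t / v y - t / v y0\<bar> \<le> r" and dq: "\<bar>u y / v y - u y0 / v y0\<bar> \<le> r"
        using y y0 by (auto simp: square_def)
      \<comment> \<open>The first parameter recovers \<open>v\<close>, at a cost of
        \<open>L^3\<close>; the second then recovers \<open>u\<close>, at a cost of
        \<open>L^5 + L\<close>.\<close>
      have "v y0 - v y = (t / v y - t / v y0) * ((1/t) * v y * v y0)" using nz by (simp add: field_simps)
      then have "\<bar>v y0 - v y\<bar> = \<bar>t / v y - t / v y0\<bar> * (\<bar>1/t\<bar> * \<bar>v y\<bar> * \<bar>v y0\<bar>)" by (simp only: abs_mult)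
      also have "\<dots> \<le> r * (L * L * L)"
      proof (intro mult_mono dp v_bd y y0)
        show "\<bar>1/t\<bar> \<le> L" using t nz L0 by (simp add: field_simps)
      qed (use L0 r0 in auto)
      finally have dv: "\<bar>v y - v y0\<bar> \<le> L^3 * r" by (simp add: abs_minus_commute power3_eq_cube mult_ac)
      have "u y - u y0 = (u y / v y) * (v y - v y0) + v y0 * (u y / v y - u y0 / v y0)" using nz by (simp add: field_simps)
      then have "\<bar>u y - u y0\<bar> \<le> \<bar>u y / v y\<bar> * \<bar>v y - v y0\<bar> + \<bar>v y0\<bar> * \<bar>u y / v y - u y0 / v y0\<bar>"
        by (metis abs_mult abs_triangle_ineq)
      also have "\<dots> \<le> L\<^sup>2 * (L^3 * r) + L * r"
        using slope_le[OF y(1)] B(2) y dv dq v_bd[OF y0(1)] L0 r0 by (intro add_mono mult_mono) auto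
      finally have "\<bar>u y - u y0\<bar> \<le> (L^5 + L) * r" by (simp add: algebra_simps flip: power_add)
      then show "\<bar>u y - u y0\<bar> \<le> 2 * L^5 * r \<and> \<bar>v y - v y0\<bar> \<le> 2 * L^5 * r"
      proof -
        have "L \<le> L^5" "L^3 \<le> L^5" "0 \<le> L^5" 
          using L_ge power_increasing[of 1 5 L] by (auto intro!: power_increasing)
        then have "(L^5 + L) * r \<le> 2 * L^5 * r" "L^3 * r \<le> 2 * L^5 * r" using r0 by (auto intro!: mult_right_mono)
        then show ?thesis using \<open>\<bar>u y - u y0\<bar> \<le> (L^5 + L) * r\<close> dv by linarith
      qed
    qed
  qed
  also have "\<dots> \<le> C * (4 * L^10 * r powr s)"
  proof (rule mult_left_mono)
    have "(2 * L^5 * r) powr s = (2 * L^5) powr s * r powr s" using L0 r0 by (simp add: powr_mult)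
    also have "(2 * L^5) powr s \<le> (2 * L^5) powr 2" 
      using s_lt one_le_power[OF L_ge, of 5] by (intro powr_mono) auto
    also have "(2 * L^5) powr 2 = 4 * L^10" using L0 by (simp add: power_mult_distrib flip: power_mult)
    finally show "(2 * L^5 * r) powr s \<le> 4 * L^10 * r powr s" by (simp add: mult_right_mono)
  qed (use C_ge in simp)
  finally show ?thesis by simp
qed

definition trace_const where "trace_const = 16 * C * L^10 * energy_const"

lemma trace_const_nonneg: "0 \<le> trace_const"
  using C_ge L_ge energy_const_nonneg by (simp add: trace_const_def)

text \<open>Cauchy-Schwarz on each square leaves \<open>4 / r\<^sup>2\<close> times an integral of
  the squared difference. After exchanging sum and integral, the squares over any \<open>z\<close>
  have total weight of order \<open>r powr s\<close>, and the energy supplies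
  \<open>r powr (s - 1)\<close>.\<close>

lemma trace_estimate:
  assumes t: "1 / L \<le> \<bar>t\<bar>" and B: "B \<subseteq> X" "\<And>y. y \<in> B \<Longrightarrow> 1 / L \<le> \<bar>v y\<bar>" and r: "\<delta> \<le> r/2" "r \<le> 1"
  shows "(\<Sum>y\<in>B. w y * (smoothed_density (r/2) (t / v y) (u y / v y) - smoothed_density r (t / v y) (u y / v y))\<^sup>2) \<le> trace_const * r powr (2 * s - 3)"
proof -
  have r0: "r > 0" using r \<delta>_pos by simp
  have fB: "finite B" using B finite_X finite_subset by blast
  have w0: "0 \<le> w y" if "y \<in> B" for y using that B w_nonneg by blast
  obtain M where M: "\<And>p q. \<bar>scale_difference r p q\<bar> \<le> M" using scale_difference_bounded by blast
  define S where "S = (\<lambda>y. square (r/2) (t / v y) (u y / v y))"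
  define g where "g = (\<lambda>z. (scale_difference r (fst z) (snd z))\<^sup>2)"
  have [measurable]: "g \<in> borel_measurable borel" unfolding g_def by measurable
  have gM: "\<bar>g z\<bar> \<le> M\<^sup>2" for z using power_mono[OF M, of _ _ 2] unfolding g_def by simp
  have int: "integrable lborel (\<lambda>z. indicator (S y) z * g z)" for y
    unfolding S_def by (rule integrable_square_mult[OF _ gM]) simp
  have "(\<Sum>y\<in>B. w y * (smoothed_density (r/2) (t / v y) (u y / v y) - smoothed_density r (t / v y) (u y / v y))\<^sup>2)
     \<le> (\<Sum>y\<in>B. w y * (4 / r\<^sup>2 * (LINT z|lborel. indicator (S y) z * g z)))"
  proof (intro sum_mono mult_left_mono w0)
    fix y assume y: "y \<in> B"
    have q: "\<bar>u y / v y\<bar> \<le> L\<^sup>2" using y B by (intro slope_le) auto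
    have "(smoothed_density (r/2) (t / v y) (u y / v y) - smoothed_density r (t / v y) (u y / v y))\<^sup>2 = 
        (4 / r\<^sup>2)\<^sup>2 * (LINT z|lborel. indicator (S y) z * scale_difference r (fst z) (snd z))\<^sup>2"
      unfolding smoothed_density_diff[OF r q] S_def power_mult_distrib ..
    also have "\<dots> \<le> (4 / r\<^sup>2)\<^sup>2 * ((r/2)\<^sup>2 * (LINT z|lborel. indicator (S y) z * g z))"
      unfolding S_def g_def using r0 by (intro mult_left_mono integral_square_cauchy_schwarz[where B=M] M) auto
    also have "\<dots> = 4 / r\<^sup>2 * (LINT z|lborel. indicator (S y) z * g z)"
      using r0 by (simp add: power2_eq_square)
    finally show "(smoothed_density (r/2) (t / v y) (u y / v y) - smoothed_density r (t / v y) (u y / v y))\<^sup>2 \<le> 4 / r\<^sup>2 * (LINT z|lborel. indicator (S y) z * g z)" .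
  qed
  also have "\<dots> = 4 / r\<^sup>2 * (LINT z|lborel. (\<Sum>y\<in>B. w y * (indicator (S y) z * g z)))"
  proof -
    have "(LINT z|lborel. (\<Sum>y\<in>B. w y * (indicator (S y) z * g z))) = (\<Sum>y\<in>B. LINT z|lborel. w y * (indicator (S y) z * g z))"
      by (rule Bochner_Integration.integral_sum) (use int in auto)
    also have "\<dots> = (\<Sum>y\<in>B. w y * (LINT z|lborel. indicator (S y) z * g z))" by simp
    finally show ?thesis by (simp only: sum_distrib_left mult.left_commute)
  qed
  also have "\<dots> \<le> 4 / r\<^sup>2 * (LINT z|lborel. (4 * C * L^10 * (r/2) powr s) * (tent Q (snd z) * g z))"
  proof (intro mult_left_mono integral_mono)
    show "integrable lborel (\<lambda>z. \<Sum>y\<in>B. w y * (indicator (S y) z * g z))" using int by auto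
    \<comment> \<open>On the support of the tent the slope is bounded, so a line with large
      \<open>p\<close> misses all kernels; this gives the compact support needed for
      integrability.\<close>
    have "scale_difference r p q = 0" if "\<bar>p\<bar> > L + Q * L + L + 2 * W * r" "\<bar>q\<bar> \<le> Q + 1" for p q
      unfolding scale_difference_eq
    proof (intro sum.neutral ballI)
      fix x assume x: "x \<in> X"
      have "\<bar>q * v x\<bar> \<le> (Q + 1) * L" unfolding abs_mult using that(2) v_bd[OF x] L_ge by (intro mult_mono) auto
      then have "\<bar>u x - p - q * v x\<bar> > 2 * W * r" using that(1) u_bd[OF x] by (simp add: algebra_simps)
      then show "w x * difference_kernel r x (u x - p - q * v x) = 0" using difference_kernel_support[OF r0 x] by simp
    qed
    note J0 = this
    have "g \<in> borel_measurable (borel \<Otimes>\<^sub>M borel)" by (simp add: borel_prod)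
    then have "(\<lambda>z. tent Q (snd z) * g z) \<in> borel_measurable (borel \<Otimes>\<^sub>M borel)" by measurable
    then have gm: "(\<lambda>z. tent Q (snd z) * g z) \<in> borel_measurable borel" by (simp add: borel_prod)
    have "integrable lborel (\<lambda>z. tent Q (snd z) * g z)"
    proof (rule integrable_bounded_support[where B="1 * M\<^sup>2" and 
          S="{-(L + Q * L + L + 2 * W * r)..L + Q * L + L + 2 * W * r} \<times> {-(Q+1)..Q+1}"])
      show "{-(L + Q * L + L + 2 * W * r)..L + Q * L + L + 2 * W * r} \<times> {-(Q+1)..Q+1} \<in> sets borel"
        by (auto simp flip: borel_prod)
      show "\<bar>tent Q (snd z) * g z\<bar> \<le> 1 * M\<^sup>2" for z 
        unfolding abs_mult by (intro mult_mono gM tent_props) auto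
      fix z assume z: "z \<notin> {-(L + Q * L + L + 2 * W * r)..L + Q * L + L + 2 * W * r} \<times> {-(Q+1)..Q+1}"
      show "tent Q (snd z) * g z = 0"
      proof (cases "\<bar>snd z\<bar> > Q + 1")
        case False
        then have "\<bar>fst z\<bar> > L + Q * L + L + 2 * W * r" using z by (cases z) auto
        then show ?thesis using J0[of "fst z" "snd z"] False by (simp add: g_def)
      qed (simp add: tent_props)
    qed (auto simp: bounded_Times gm)
    then show "integrable lborel (\<lambda>z. (4 * C * L^10 * (r/2) powr s) * (tent Q (snd z) * g z))" by simp
    fix z
    have "(\<Sum>y\<in>B. w y * (indicator (S y) z * g z)) = (\<Sum>y\<in>B. w y * indicator (S y) z) * (tent Q (snd z) * g z)"
    proof -
      \<comment> \<open>Slopes in the squares attached to \<open>B\<close> are at most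
        \<open>Q\<close> in modulus, where the tent equals 1, so it can be inserted freely.\<close>
      have "indicator (S y) z * g z = indicator (S y) z * (tent Q (snd z) * g z)" if y: "y \<in> B" for y
      proof (cases "z \<in> S y")
        case True
        have "\<bar>snd z\<bar> \<le> Q" 
          using square_snd_le[of "r/2" "u y / v y" z "t / v y"] True slope_le[of y] B y r r0 unfolding S_def by auto
        then show ?thesis by (simp add: tent_props)
      qed simp
      then show ?thesis unfolding sum_distrib_right by (intro sum.cong) auto
    qed
    also have "\<dots> \<le> (4 * C * L^10 * (r/2) powr s) * (tent Q (snd z) * g z)"
      unfolding S_def using t B r tent_props(2)
      by (intro mult_right_mono line_cell_mass) (auto simp: g_def)
    finally show "(\<Sum>y\<in>B. w y * (indicator (S y) z * g z)) \<le> (4 * C * L^10 * (r/2) powr s) * (tent Q (snd z) * g z)" .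
  qed simp
  also have "\<dots> = 4 / r\<^sup>2 * ((4 * C * L^10 * (r/2) powr s) * (LINT z|lborel. tent Q (snd z) * g z))"
    by simp
  also have "\<dots> \<le> 4 / r\<^sup>2 * ((4 * C * L^10 * r powr s) * (energy_const * r powr (s - 1)))"
  proof (intro mult_left_mono mult_mono)
    show "(r/2) powr s \<le> r powr s" using r0 s_gt by (intro powr_mono2) auto
    show "(LINT z|lborel. tent Q (snd z) * g z) \<le> energy_const * r powr (s - 1)"
      unfolding g_def using r r0 by (intro scale_difference_energy) auto
    show "0 \<le> (LINT z|lborel. tent Q (snd z) * g z)" 
      using tent_props(2) by (intro Bochner_Integration.integral_nonneg) (auto simp: g_def)
  qed (use C_ge L_ge in auto)
  also have "\<dots> = trace_const * r powr (2 * s - 3)"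
  proof -
    have eq: "r powr (2 * s - 3) = r powr s * r powr (s - 1) / r\<^sup>2"
    proof -
      have "r\<^sup>2 = r powr 2" using r0 by simp
      then show ?thesis by (simp only: powr_add[symmetric] powr_diff[symmetric]) simp
    qed
    then show ?thesis unfolding trace_const_def unfolding eq by simp
  qed
  finally show ?thesis .
qed

text \<open>The density at \<open>(t1, t2)\<close> of the pairs of determinants at resolution \<open>r\<close>.\<close>

definition pair_density where
  "pair_density B r t1 t2 = (\<Sum>y\<in>B. w y * (smoothed_density r (t1 / v y) (u y / v y) * smoothed_density r (t2 / v y) (u y / v y)))"

definition step_const where "step_const = 2 * strip_const * (C * L\<^sup>2 + trace_const)"

lemma step_const_nonneg: "0 \<le> step_const"
  using C_ge strip_const_nonneg trace_const_nonneg by (simp add: step_const_def)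

text \<open>The exponent is \<open>s - 2\<close> from the pointwise bound of one factor plus \<open>s - 3/2\<close> from the \<open>L\<^sup>2\<close> bound
  of the other; it is positive exactly when \<open>s > 7/4\<close>.\<close>

lemma pair_density_step:
  assumes t: "1 / L \<le> \<bar>t1\<bar>" "1 / L \<le> \<bar>t2\<bar>" and B: "B \<subseteq> X" "\<And>y. y \<in> B \<Longrightarrow> 1 / L \<le> \<bar>v y\<bar>"
    and r: "\<delta> \<le> r/2" "r \<le> 1"
  shows "\<bar>pair_density B (r/2) t1 t2 - pair_density B r t1 t2\<bar> \<le> step_const * r powr (2 * s - 7/2)"
proof -
  have r0: "r > 0" using r \<delta>_pos by simp
  have w0: "0 \<le> w y" if "y \<in> B" for y using that B w_nonneg by blast
  define f g where "f = (\<lambda>t y. smoothed_density r (t / v y) (u y / v y))" and "g = (\<lambda>t y. smoothed_density (r/2) (t / v y) (u y / v y))"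
  \<comment> \<open>The factor 2 covers the finer scale: halving \<open>r\<close> enlarges
    \<open>r powr (s - 2)\<close> by \<open>2 powr (2 - s)\<close>, which is below 2.\<close>
  define K where "K = 2 * strip_const * r powr (s - 2)"
  have K0: "0 \<le> K" using strip_const_nonneg by (simp add: K_def)
  \<comment> \<open>The square root of \<open>r powr (2 * s - 3)\<close>: with this weight both
    terms of the arithmetic-geometric inequality below have the same order.\<close>
  define \<mu> where "\<mu> = r powr (s - 3/2)"
  have \<mu>: "\<mu> > 0" using r0 by (simp add: \<mu>_def)
  have fK: "0 \<le> f t y \<and> f t y \<le> K" "0 \<le> g t y \<and> g t y \<le> K" if y: "y \<in> B" for t y
  proof -
    have q: "\<bar>u y / v y\<bar> \<le> L\<^sup>2" using y B by (intro slope_le) auto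
    have 1: "strip_const * r powr (s - 2) \<le> K" unfolding K_def using strip_const_nonneg by simp
    show "0 \<le> f t y \<and> f t y \<le> K" unfolding f_def using smoothed_density_bounds[OF _ r(2) q] r r0 1 by (force intro: order_trans)
    have "(r/2) powr (s - 2) = r powr (s - 2) * 2 powr (2 - s)" using r0 by (simp add: powr_divide powr_diff field_simps)
    also have "\<dots> \<le> r powr (s - 2) * 2 powr 1" using s_gt by (intro mult_left_mono powr_mono) auto
    finally have "strip_const * (r/2) powr (s - 2) \<le> strip_const * (r powr (s - 2) * 2 powr 1)"
      using strip_const_nonneg by (rule mult_left_mono)
    then have "strip_const * (r/2) powr (s - 2) \<le> K" by (simp add: K_def mult_ac)
    then show "0 \<le> g t y \<and> g t y \<le> K" unfolding g_def using smoothed_density_bounds[OF r(1) _ q] r r0 by (force intro: order_trans)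
  qed
  have D: "(\<Sum>y\<in>B. w y * \<bar>g t y - f t y\<bar>) \<le> (C * L\<^sup>2 + trace_const) / 2 * \<mu>" if t: "1 / L \<le> \<bar>t\<bar>" for t
  proof -
    have "(\<Sum>y\<in>B. w y * \<bar>g t y - f t y\<bar>) \<le> (\<Sum>y\<in>B. w y * ((\<mu> + (g t y - f t y)\<^sup>2 / \<mu>) / 2))"
    proof (intro sum_mono mult_left_mono w0)
      fix y
      define d where "d = \<bar>g t y - f t y\<bar>"
      have "0 \<le> (\<mu> - d)\<^sup>2" by simp
      then have "2 * \<mu> * d \<le> \<mu>\<^sup>2 + d\<^sup>2" by (simp add: power2_diff)
      then have "d \<le> (\<mu> + d\<^sup>2 / \<mu>) / 2" using \<mu> by (simp add: field_simps power2_eq_square)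
      then show "\<bar>g t y - f t y\<bar> \<le> (\<mu> + (g t y - f t y)\<^sup>2 / \<mu>) / 2" by (simp add: d_def)
    qed
    also have "\<dots> = (sum w B * \<mu> + (\<Sum>y\<in>B. w y * (g t y - f t y)\<^sup>2) / \<mu>) / 2"
      unfolding sum_distrib_right sum_divide_distrib sum.distrib[symmetric]
      by (intro sum.cong) (simp_all add: field_simps)
    also have "\<dots> \<le> ((C * L\<^sup>2) * \<mu> + trace_const * r powr (2 * s - 3) / \<mu>) / 2"
    proof (intro divide_right_mono add_mono mult_right_mono)
      have "sum w B \<le> sum w X" using B finite_X w_nonneg by (intro sum_mono2) auto
      then show "sum w B \<le> C * L\<^sup>2" using mass_le by simp
      show "(\<Sum>y\<in>B. w y * (g t y - f t y)\<^sup>2) \<le> trace_const * r powr (2 * s - 3)"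
        unfolding f_def g_def using t B r by (rule trace_estimate)
    qed (use \<mu> in auto)
    also have "r powr (2 * s - 3) = \<mu> * \<mu>" unfolding \<mu>_def by (simp flip: powr_add)
    also have "((C * L\<^sup>2) * \<mu> + trace_const * (\<mu> * \<mu>) / \<mu>) / 2 = (C * L\<^sup>2 + trace_const) / 2 * \<mu>"
      using \<mu> by (simp add: field_simps)
    finally show ?thesis .
  qed
  have "pair_density B (r/2) t1 t2 - pair_density B r t1 t2 = (\<Sum>y\<in>B. w y * (g t1 y * g t2 y - f t1 y * f t2 y))"
    unfolding pair_density_def f_def g_def by (simp add: sum_subtractf right_diff_distrib)
  also have "\<bar>\<dots>\<bar> \<le> (\<Sum>y\<in>B. \<bar>w y * (g t1 y * g t2 y - f t1 y * f t2 y)\<bar>)" by (rule sum_abs)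
  also have "\<dots> \<le> (\<Sum>y\<in>B. w y * (K * (\<bar>g t1 y - f t1 y\<bar> + \<bar>g t2 y - f t2 y\<bar>)))"
  proof (intro sum_mono)
    fix y assume y: "y \<in> B"
    have "g t1 y * g t2 y - f t1 y * f t2 y = (g t1 y - f t1 y) * g t2 y + f t1 y * (g t2 y - f t2 y)"
      by (simp add: algebra_simps)
    then have "\<bar>g t1 y * g t2 y - f t1 y * f t2 y\<bar> \<le> \<bar>g t1 y - f t1 y\<bar> * \<bar>g t2 y\<bar> + \<bar>f t1 y\<bar> * \<bar>g t2 y - f t2 y\<bar>"
      by (metis abs_mult abs_triangle_ineq)
    also have "\<dots> \<le> \<bar>g t1 y - f t1 y\<bar> * K + K * \<bar>g t2 y - f t2 y\<bar>"
      using fK[OF y] K0 by (intro add_mono mult_mono) auto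
    finally have "\<bar>g t1 y * g t2 y - f t1 y * f t2 y\<bar> \<le> K * (\<bar>g t1 y - f t1 y\<bar> + \<bar>g t2 y - f t2 y\<bar>)"
      by (simp add: algebra_simps)
    then show "\<bar>w y * (g t1 y * g t2 y - f t1 y * f t2 y)\<bar> \<le> w y * (K * (\<bar>g t1 y - f t1 y\<bar> + \<bar>g t2 y - f t2 y\<bar>))"
      using w0[OF y] by (simp add: abs_mult mult_left_mono)
  qed
  also have "\<dots> = K * ((\<Sum>y\<in>B. w y * \<bar>g t1 y - f t1 y\<bar>) + (\<Sum>y\<in>B. w y * \<bar>g t2 y - f t2 y\<bar>))"
    by (simp add: sum.distrib sum_distrib_left algebra_simps)
  also have "\<dots> \<le> K * ((C * L\<^sup>2 + trace_const) / 2 * \<mu> + (C * L\<^sup>2 + trace_const) / 2 * \<mu>)"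
    using K0 by (intro mult_left_mono add_mono D t)
  also have "\<dots> = step_const * (r powr (s - 2) * r powr (s - 3/2))"
    unfolding K_def step_const_def \<mu>_def by (simp add: algebra_simps)
  also have "r powr (s - 2) * r powr (s - 3/2) = r powr (2 * s - 7/2)" by (simp flip: powr_add)
  finally show ?thesis .
qed

text \<open>Telescoping over the scales between \<open>k\<close> and \<open>k + n\<close> gives a
  geometric series of ratio below 1. The total loss is bounded independently of \<open>n\<close> and
  tends to 0 as \<open>k\<close> grows.\<close>

lemma pair_density_lower:
  assumes t: "1 / L \<le> \<bar>t1\<bar>" "1 / L \<le> \<bar>t2\<bar>" and B: "B \<subseteq> X" "\<And>y. y \<in> B \<Longrightarrow> 1 / L \<le> \<bar>v y\<bar>"
    and s: "7/4 < s" and n: "\<delta> \<le> (1/2)^(k+n)"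
  shows "pair_density B ((1/2)^(k+n)) t1 t2 \<ge> pair_density B ((1/2)^k) t1 t2 
     - step_const * (2 powr (7/2 - 2 * s))^k / (1 - 2 powr (7/2 - 2 * s))"
proof -
  define \<theta> where "\<theta> = 2 powr (7/2 - 2 * s)"
  have \<theta>: "0 < \<theta>" "\<theta> < 1" unfolding \<theta>_def using s powr_less_mono[of "7/2 - 2 * s" 0 2] by auto
  have pw: "((1/2)^j) powr (2 * s - 7/2) = \<theta>^j" for j :: nat
  proof -
    have "((1/2::real)^j) powr (2 * s - 7/2) = ((1/2) powr (2 * s - 7/2))^j" 
      by (simp add: powr_power powr_powr powr_realpow[symmetric] mult_ac)
    also have "(1/2::real) powr (2 * s - 7/2) = \<theta>" unfolding \<theta>_def by (simp add: powr_divide powr_diff)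
    finally show ?thesis .
  qed
  have "pair_density B ((1/2)^(k+n)) t1 t2 \<ge> pair_density B ((1/2)^k) t1 t2 - step_const * (\<Sum>i<n. \<theta>^(k+i))"
    using n
  proof (induction n)
    case (Suc n)
    have d: "\<delta> \<le> (1/2)^(k+n) / 2" using Suc.prems by simp
    then have "\<delta> \<le> (1/2)^(k+n)" using \<delta>_pos by simp
    note IH = Suc.IH[OF this]
    have "\<bar>pair_density B ((1/2)^(k+n)/2) t1 t2 - pair_density B ((1/2)^(k+n)) t1 t2\<bar> \<le> step_const * \<theta>^(k+n)"
      unfolding pw[symmetric] using t B d by (intro pair_density_step) (auto simp: power_le_one)
    moreover have "(1/2::real)^(k + Suc n) = (1/2)^(k+n)/2" by simp
    ultimately show ?case using IH by (simp add: algebra_simps)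
  qed simp
  moreover have "step_const * (\<Sum>i<n. \<theta>^(k+i)) \<le> step_const * (\<theta>^k * (1 / (1 - \<theta>)))"
  proof (intro mult_left_mono step_const_nonneg)
    have "(\<Sum>i<n. \<theta>^i) \<le> (\<Sum>i. \<theta>^i)" using \<theta> by (intro sum_le_suminf summable_geometric) auto
    also have "\<dots> = 1 / (1 - \<theta>)" using \<theta> by (intro suminf_geometric) auto
    finally show "(\<Sum>i<n. \<theta>^(k+i)) \<le> \<theta>^k * (1 / (1 - \<theta>))" 
      unfolding power_add sum_distrib_left[symmetric] using \<theta> by (intro mult_left_mono) auto
  qed
  ultimately show ?thesis by (simp add: \<theta>_def)
qed

end

section \<open>Pairs of determinants\<close>

lemma sum_pos_witness:
  fixes f :: "'a \<Rightarrow> real"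
  assumes "0 < sum f A" shows "\<exists>y\<in>A. 0 < f y"
proof (rule ccontr)
  assume "\<not> ?thesis"
  then have "sum f A \<le> 0" by (intro sum_nonpos) (auto simp: not_less)
  then show False using assms by simp
qed

context frostman_points
begin

text \<open>The line \<open>v = 0\<close> is not of the form \<open>u = p + q v\<close>; after
  exchanging the coordinates it is, so \<open>strip_mass_le\<close> also applies to strips around
  it.\<close>

lemma swap: "frostman_points X v u w s C L \<delta>"
  by unfold_locales (use finite_X w_nonneg s_gt s_lt C_ge L_ge \<delta>_pos \<delta>_le u_bd v_bd frostman in \<open>auto simp: conj_commute\<close>)

text \<open>This allows \<open>L\<close> to grow in stages, each threshold being chosen from a mass
  bound with the previous value.\<close>

lemma mono_L: "L \<le> L' \<Longrightarrow> frostman_points X u v w s C L' \<delta>"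
  by unfold_locales (use finite_X w_nonneg s_gt s_lt C_ge L_ge \<delta>_pos \<delta>_le u_bd v_bd frostman in \<open>auto intro: order_trans\<close>)

definition det where "det x y = u x * v y - v x * u y"

definition cells :: "real \<Rightarrow> int set" where "cells h = {\<lfloor>-2 * L\<^sup>2 / h\<rfloor>..\<lfloor>2 * L\<^sup>2 / h\<rfloor>}"

lemma det_bound: "x \<in> X \<Longrightarrow> y \<in> X \<Longrightarrow> \<bar>det x y\<bar> \<le> 2 * L\<^sup>2"
proof -
  assume xy: "x \<in> X" "y \<in> X"
  have "\<bar>u x * v y\<bar> \<le> L * L" "\<bar>v x * u y\<bar> \<le> L * L"
    unfolding abs_mult using xy u_bd v_bd L_ge by (auto intro!: mult_mono)
  then show ?thesis unfolding det_def power2_eq_square by linarith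
qed

lemma cells_floor:
  assumes "x \<in> X" "y \<in> X" "h > 0" shows "\<lfloor>det x y / h\<rfloor> \<in> cells h"
proof -
  have "-2 * L\<^sup>2 \<le> det x y" "det x y \<le> 2 * L\<^sup>2" using det_bound[OF assms(1,2)] by auto
  then have "-2 * L\<^sup>2 / h \<le> det x y / h" "det x y / h \<le> 2 * L\<^sup>2 / h" 
    using assms(3) by (simp_all only: divide_right_mono less_imp_le)
  then show ?thesis unfolding cells_def by (auto intro: floor_mono)
qed

lemma card_cells:
  assumes "0 < h" "h \<le> 1" shows "real (card (cells h)) \<le> 6 * L\<^sup>2 / h"
proof -
  have 1: "1 \<le> L\<^sup>2 / h" using assms order_trans[OF assms(2) one_le_power[OF L_ge, of 2]] by (simp add: field_simps)
  have "-2 * L\<^sup>2 / h \<le> 2 * L\<^sup>2 / h" using assms by (intro divide_right_mono) auto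
  then have "\<lfloor>-2 * L\<^sup>2 / h\<rfloor> \<le> \<lfloor>2 * L\<^sup>2 / h\<rfloor>" by (intro floor_mono)
  then have "real (card (cells h)) = real_of_int (\<lfloor>2 * L\<^sup>2 / h\<rfloor> - \<lfloor>-2 * L\<^sup>2 / h\<rfloor> + 1)"
    unfolding cells_def by simp
  also have "\<dots> \<le> 2 * L\<^sup>2 / h - (-2 * L\<^sup>2 / h) + 2" by linarith
  also have "\<dots> = 4 * (L\<^sup>2 / h) + 2" by simp
  also have "\<dots> \<le> 6 * L\<^sup>2 / h" using 1 by simp
  finally show ?thesis .
qed

text \<open>The lower bound must not depend on \<open>r\<close>: the cells have side comparable to \<open>r\<close>, so the \<open>r\<^sup>2\<close> lost in the
  pigeonhole over cells is regained from the normalisation of the density.\<close>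

lemma heavy_cell:
  assumes B: "B \<subseteq> X" "\<And>y. y \<in> B \<Longrightarrow> 1 / L \<le> \<bar>v y\<bar>" "m \<le> sum w B" and m: "0 < m"
    and \<tau>: "2 / L \<le> \<tau>" "\<And>y. y \<in> B \<Longrightarrow> m \<le> (\<Sum>x\<in>{x\<in>X. \<bar>det x y\<bar> > \<tau>}. w x)"
    and r: "\<delta> \<le> r" "r \<le> 1"
  shows "\<exists>i\<in>cells (r/L). \<exists>j\<in>cells (r/L). \<forall>t1 t2. \<lfloor>t1 / (r/L)\<rfloor> = i \<and> \<lfloor>t2 / (r/L)\<rfloor> = j \<longrightarrow>
      1 / L \<le> \<bar>t1\<bar> \<and> 1 / L \<le> \<bar>t2\<bar> \<and> m^3 / (36 * L^6) \<le> pair_density B r t1 t2"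
proof -
  have r0: "r > 0" and L0: "L > 0" using r \<delta>_pos L_ge by auto
  \<comment> \<open>Dividing a determinant by \<open>v y\<close> magnifies errors by at most
    \<open>L\<close>, so values in one cell give lines at most \<open>r\<close> apart.\<close>
  define h where "h = r / L"
  have h: "0 < h" "h \<le> 1" using r0 r L_ge by (auto simp: h_def field_simps)
  define I where "I = cells h"
  have fI: "finite I" by (simp add: I_def cells_def)
  define A where "A = (\<lambda>i y. \<Sum>x\<in>{x\<in>X. \<bar>det x y\<bar> > \<tau> \<and> \<lfloor>det x y / h\<rfloor> = i}. w x)"
  have A0: "0 \<le> A i y" for i y unfolding A_def using w_nonneg by (intro sum_nonneg) auto
  have w0: "0 \<le> w y" if "y \<in> B" for y using that B w_nonneg by blast
  define G where "G = (\<lambda>i j. \<Sum>y\<in>B. w y * (A i y * A j y))"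
  have A_total: "m \<le> (\<Sum>i\<in>I. A i y)" if y: "y \<in> B" for y
  proof -
    have "(\<Sum>i\<in>I. \<Sum>x\<in>{x\<in>{x\<in>X. \<bar>det x y\<bar> > \<tau>}. \<lfloor>det x y / h\<rfloor> = i}. w x) = (\<Sum>x\<in>{x\<in>X. \<bar>det x y\<bar> > \<tau>}. w x)"
      using finite_X fI y B cells_floor h by (intro sum.group) (auto simp: I_def)
    moreover have "{x\<in>{x\<in>X. \<bar>det x y\<bar> > \<tau>}. \<lfloor>det x y / h\<rfloor> = i} = {x\<in>X. \<bar>det x y\<bar> > \<tau> \<and> \<lfloor>det x y / h\<rfloor> = i}" for i by auto
    ultimately show ?thesis unfolding A_def using \<tau>(2)[OF y] by simp
  qed
  \<comment> \<open>One factor \<open>m\<close> for each of the three points \<open>x\<close>,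
    \<open>y\<close>, \<open>z\<close>.\<close>
  have "m^3 \<le> sum w B * m^2" using B(3) m by (simp add: power3_eq_cube power2_eq_square mult_right_mono)
  also have "\<dots> = (\<Sum>y\<in>B. w y * (m * m))" by (simp add: sum_distrib_right power2_eq_square)
  also have "\<dots> \<le> (\<Sum>y\<in>B. w y * ((\<Sum>i\<in>I. A i y) * (\<Sum>j\<in>I. A j y)))"
    using A_total m w0 by (intro sum_mono mult_left_mono mult_mono) (auto intro: order_trans[of _ m])
  also have "\<dots> = (\<Sum>i\<in>I. \<Sum>j\<in>I. G i j)"
  proof -
    have "(\<Sum>i\<in>I. \<Sum>j\<in>I. G i j) = (\<Sum>i\<in>I. \<Sum>y\<in>B. \<Sum>j\<in>I. w y * (A i y * A j y))"
      unfolding G_def by (intro sum.cong refl sum.swap)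
    also have "\<dots> = (\<Sum>y\<in>B. \<Sum>i\<in>I. \<Sum>j\<in>I. w y * (A i y * A j y))" by (rule sum.swap)
    also have "\<dots> = (\<Sum>y\<in>B. w y * ((\<Sum>i\<in>I. A i y) * (\<Sum>j\<in>I. A j y)))"
      by (intro sum.cong refl) (simp only: sum_product, simp only: sum_distrib_left)
    finally show ?thesis ..
  qed
  finally have tot: "m^3 \<le> (\<Sum>i\<in>I. \<Sum>j\<in>I. G i j)" .
  have "\<exists>i\<in>I. \<exists>j\<in>I. m^3 / (6 * L\<^sup>2 / h)\<^sup>2 \<le> G i j"
  proof (rule ccontr)
    assume "\<not> ?thesis"
    then have lt: "G i j < m^3 / (6 * L\<^sup>2 / h)\<^sup>2" if "i \<in> I" "j \<in> I" for i j using that by force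
    have ne: "I \<noteq> {}" using tot m by auto
    have "(\<Sum>i\<in>I. \<Sum>j\<in>I. G i j) < (\<Sum>i\<in>I. \<Sum>j\<in>I. m^3 / (6 * L\<^sup>2 / h)\<^sup>2)"
      using lt fI ne by (intro sum_strict_mono) auto
    also have "\<dots> = (real (card I))\<^sup>2 * (m^3 / (6 * L\<^sup>2 / h)\<^sup>2)" by (simp add: power2_eq_square)
    also have "\<dots> \<le> (6 * L\<^sup>2 / h)\<^sup>2 * (m^3 / (6 * L\<^sup>2 / h)\<^sup>2)"
      using card_cells[OF h] m unfolding I_def by (intro mult_right_mono power_mono) auto
    also have "\<dots> = m^3" using L0 h by simp
    finally show False using tot by simp
  qed
  then obtain i j where ij: "i \<in> I" "j \<in> I" "m^3 / (6 * L\<^sup>2 / h)\<^sup>2 \<le> G i j" by blast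
  have "0 < m^3 / (6 * L\<^sup>2 / h)\<^sup>2" using m L0 h by simp
  then have Gpos: "G i j > 0" using ij by linarith
  then obtain y where y: "y \<in> B" "w y * (A i y * A j y) > 0"
    unfolding G_def using sum_pos_witness by blast
  then have "A i y \<noteq> 0" "A j y \<noteq> 0" by auto
  moreover have "\<exists>x\<in>X. \<bar>det x y\<bar> > \<tau> \<and> \<lfloor>det x y / h\<rfloor> = i" if "A i y \<noteq> 0" for i
    using that unfolding A_def by (rule contrapos_np) (rule sum.neutral, blast)
  ultimately obtain x z where xz: "x \<in> X" "\<bar>det x y\<bar> > \<tau>" "\<lfloor>det x y / h\<rfloor> = i" 
    "z \<in> X" "\<bar>det z y\<bar> > \<tau>" "\<lfloor>det z y / h\<rfloor> = j"
    by blast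
  have close: "\<bar>a - b\<bar> \<le> h" if "\<lfloor>a / h\<rfloor> = \<lfloor>b / h\<rfloor>" for a b
  proof -
    have "\<bar>a / h - b / h\<bar> \<le> 1" using that by linarith
    then have "\<bar>a - b\<bar> / h \<le> 1" using h by (simp flip: diff_divide_distrib)
    then show ?thesis using h by simp
  qed
  \<comment> \<open>A cell has length at most \<open>1 / L\<close> and contains a determinant of
    modulus above \<open>2 / L\<close>, so all of its values keep modulus at least
    \<open>1 / L\<close>.\<close>
  have hL: "h \<le> 1 / L" unfolding h_def using r L0 by (simp add: divide_right_mono)
  show ?thesis unfolding h_def[symmetric] I_def[symmetric]
  proof (rule bexI[OF _ ij(1)], rule bexI[OF _ ij(2)], intro allI impI)
    fix t1 t2 assume t: "\<lfloor>t1 / h\<rfloor> = i \<and> \<lfloor>t2 / h\<rfloor> = j"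
    have "\<bar>det x y - t1\<bar> \<le> h" "\<bar>det z y - t2\<bar> \<le> h" using t xz by (auto intro: close)
    moreover have "2 / L = 1 / L + 1 / L" by simp
    ultimately have t12: "1 / L \<le> \<bar>t1\<bar>" "1 / L \<le> \<bar>t2\<bar>" using xz \<tau>(1) hL by linarith+
    have AF: "A i y / r \<le> smoothed_density r (t / v y) (u y / v y)" if y: "y \<in> B" and t: "\<lfloor>t / h\<rfloor> = i" for i t y
    proof -
      have q: "\<bar>u y / v y\<bar> \<le> L\<^sup>2" using y B by (intro slope_le) auto
      have "0 < 1 / L" using L0 by simp
      then have "0 < \<bar>v y\<bar>" using B(2)[OF y] by linarith
      then have vy: "v y \<noteq> 0" "\<bar>1 / v y\<bar> \<le> L" using B(2)[OF y] L0 by (simp_all add: field_simps)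
      have "A i y \<le> (\<Sum>x\<in>{x\<in>X. \<bar>u x - t / v y - u y / v y * v x\<bar> \<le> r}. w x)"
        unfolding A_def
      proof (rule sum_mono2)
        show "{x \<in> X. \<tau> < \<bar>det x y\<bar> \<and> \<lfloor>det x y / h\<rfloor> = i} \<subseteq> {x \<in> X. \<bar>u x - t / v y - u y / v y * v x\<bar> \<le> r}"
        proof safe
          fix x assume x: "x \<in> X" "i = \<lfloor>det x y / h\<rfloor>"
          have "u x - t / v y - u y / v y * v x = (det x y - t) * (1 / v y)"
            unfolding det_def using vy by (simp add: field_simps)
          then have "\<bar>u x - t / v y - u y / v y * v x\<bar> = \<bar>det x y - t\<bar> * \<bar>1 / v y\<bar>" by (simp only: abs_mult)
          also have "\<dots> \<le> h * L" using close[of "det x y" t] t x vy h by (intro mult_mono) auto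
          also have "\<dots> = r" using L0 by (simp add: h_def)
          finally show "\<bar>u x - t / v y - u y / v y * v x\<bar> \<le> r" .
        qed
      qed (use finite_X w_nonneg in auto)
      then have "A i y / r \<le> (\<Sum>x\<in>{x\<in>X. \<bar>u x - t / v y - u y / v y * v x\<bar> \<le> r}. w x) / r"
        using r0 by (intro divide_right_mono) auto
      also have "\<dots> \<le> smoothed_density r (t / v y) (u y / v y)" by (rule smoothed_density_lower[OF r q])
      finally show ?thesis .
    qed
    \<comment> \<open>The powers of \<open>r\<close> cancel because
      \<open>h = r / L\<close>.\<close>
    have "m^3 / (36 * L^6) = m^3 / (6 * L\<^sup>2 / h)\<^sup>2 / r\<^sup>2"
      using r0 L0 by (simp add: h_def power_divide power_mult_distrib flip: power_mult power_add)
    also have "\<dots> \<le> G i j / r\<^sup>2" using ij(3) by (intro divide_right_mono) auto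
    also have "\<dots> = (\<Sum>y\<in>B. w y * (A i y / r * (A j y / r)))"
      unfolding G_def by (simp add: sum_divide_distrib power2_eq_square)
    also have "\<dots> \<le> pair_density B r t1 t2" unfolding pair_density_def
    proof (intro sum_mono mult_left_mono mult_mono)
      fix y assume y: "y \<in> B"
      show "A i y / r \<le> smoothed_density r (t1 / v y) (u y / v y)" "A j y / r \<le> smoothed_density r (t2 / v y) (u y / v y)"
        using AF y t by auto
      then show "0 \<le> smoothed_density r (t1 / v y) (u y / v y)" using A0[of i y] r0 by (meson divide_nonneg_pos order_trans)
      show "0 \<le> w y" using y by (rule w0)
    qed (use A0 r0 in auto)
    finally show "1 / L \<le> \<bar>t1\<bar> \<and> 1 / L \<le> \<bar>t2\<bar> \<and> m^3 / (36 * L^6) \<le> pair_density B r t1 t2" using t12 by blast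
  qed
qed

lemma pair_density_pos_witness:
  assumes B: "B \<subseteq> X" "\<And>y. y \<in> B \<Longrightarrow> 1 / L \<le> \<bar>v y\<bar>" and r: "\<delta> \<le> r" "r \<le> 1" and pair_density: "0 < pair_density B r t1 t2"
  shows "\<exists>x\<in>X. \<exists>y\<in>X. \<exists>z\<in>X. \<bar>det x y - t1\<bar> \<le> 2 * W * L * r \<and> \<bar>det z y - t2\<bar> \<le> 2 * W * L * r"
proof -
  have r0: "r > 0" using r \<delta>_pos by simp
  obtain y where y: "y \<in> B" "w y * (smoothed_density r (t1 / v y) (u y / v y) * smoothed_density r (t2 / v y) (u y / v y)) > 0"
    using pair_density unfolding pair_density_def using sum_pos_witness by blast
  have q: "\<bar>u y / v y\<bar> \<le> L\<^sup>2" using y B by (intro slope_le) auto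
  have "0 < 1 / L" using L_ge by simp
  moreover have "1 / L \<le> \<bar>v y\<bar>" using B y by blast
  ultimately have "0 < \<bar>v y\<bar>" by linarith
  then have vy: "v y \<noteq> 0" "\<bar>v y\<bar> \<le> L" using B y v_bd by auto
  have "smoothed_density r (t1 / v y) (u y / v y) \<noteq> 0" "smoothed_density r (t2 / v y) (u y / v y) \<noteq> 0" using y by auto
  then have "0 < smoothed_density r (t1 / v y) (u y / v y)" "0 < smoothed_density r (t2 / v y) (u y / v y)"
    using smoothed_density_bounds(1)[OF r q] by (simp_all add: order.strict_iff_order eq_commute[of 0])
  note smoothed_density_pos_witness[OF r0 this(1)] smoothed_density_pos_witness[OF r0 this(2)]
  then obtain x z where xz: "x \<in> X" "\<bar>u x - t1 / v y - u y / v y * v x\<bar> \<le> 2 * W * r" 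
    "z \<in> X" "\<bar>u z - t2 / v y - u y / v y * v z\<bar> \<le> 2 * W * r" by blast
  have "\<bar>det x y - t\<bar> \<le> 2 * W * L * r" if "\<bar>u x - t / v y - u y / v y * v x\<bar> \<le> 2 * W * r" for x t
  proof -
    have "det x y - t = (u x - t / v y - u y / v y * v x) * v y" unfolding det_def using vy by (simp add: field_simps)
    then have "\<bar>det x y - t\<bar> = \<bar>u x - t / v y - u y / v y * v x\<bar> * \<bar>v y\<bar>" by (simp only: abs_mult)
    also have "\<dots> \<le> (2 * W * r) * L" using that vy W_ge r0 by (intro mult_mono) auto
    finally show ?thesis by (simp add: mult_ac)
  qed
  then show ?thesis using xz y B by blast
qed

lemma horizontal_strip_mass:
  assumes "\<delta> \<le> \<rho>" "\<rho> \<le> 1"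
  shows "(\<Sum>y\<in>{y\<in>X. \<bar>v y\<bar> \<le> \<rho>}. w y) \<le> 4 * L * C * \<rho> powr (s - 1)"
proof -
  interpret swapped: frostman_points X v u w s C L \<delta> by (rule swap)
  show ?thesis using swapped.strip_mass_le[OF assms, of 0 0 1 0] by simp
qed

text \<open>\<open>det x y / v y\<close> is the offset \<open>u x - (u y / v y) * v x\<close> of
  \<open>x\<close> from the line through the origin and \<open>y\<close>, so a small determinant
  places \<open>x\<close> in a thin strip.\<close>

lemma det_strip_mass:
  assumes "\<delta> \<le> \<sigma>" "\<sigma> \<le> 1" and y: "y \<in> X" "1 / L \<le> \<bar>v y\<bar>"
  shows "(\<Sum>x\<in>{x\<in>X. \<bar>det x y\<bar> \<le> \<sigma> / L}. w x) \<le> 4 * L * C * (1 + L\<^sup>2)\<^sup>2 * \<sigma> powr (s - 1)"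
proof -
  have L0: "0 < L" using L_ge by simp
  then have "0 < 1 / L" by simp
  then have vy: "0 < \<bar>v y\<bar>" using y(2) by linarith
  have "(\<Sum>x\<in>{x\<in>X. \<bar>det x y\<bar> \<le> \<sigma> / L}. w x) \<le> (\<Sum>x\<in>{x\<in>X. \<bar>u x - 0 - u y / v y * v x\<bar> \<le> 1 * \<sigma>}. w x)"
  proof (rule sum_mono2)
    show "{x \<in> X. \<bar>det x y\<bar> \<le> \<sigma> / L} \<subseteq> {x \<in> X. \<bar>u x - 0 - u y / v y * v x\<bar> \<le> 1 * \<sigma>}"
    proof safe
      fix x assume "x \<in> X" and x: "\<bar>det x y\<bar> \<le> \<sigma> / L"
      have "u x - 0 - u y / v y * v x = det x y / v y" unfolding det_def using vy by (simp add: field_simps)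
      then have "\<bar>u x - 0 - u y / v y * v x\<bar> = \<bar>det x y\<bar> * (1 / \<bar>v y\<bar>)" by simp
      also have "\<dots> \<le> (\<sigma> / L) * L" using x vy L0 y(2) \<delta>_pos assms(1) by (intro mult_mono) (auto simp: field_simps)
      finally show "\<bar>u x - 0 - u y / v y * v x\<bar> \<le> 1 * \<sigma>" using L0 by simp
    qed
  qed (use finite_X w_nonneg in auto)
  also have "\<dots> \<le> 4 * L * C * (1 + L\<^sup>2)\<^sup>2 * \<sigma> powr (s - 1)"
    using assms(1,2) slope_le[OF y] by (rule strip_mass_le) simp
  finally show ?thesis .
qed

lemma approximate_hits:
  assumes s: "7/4 < s" and \<delta>: "\<delta> \<le> (1/2)^(k+n)"
    and B: "B \<subseteq> X" "\<And>y. y \<in> B \<Longrightarrow> 1 / L \<le> \<bar>v y\<bar>" "m \<le> sum w B" and m: "0 < m"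
    and \<tau>: "2 / L \<le> \<tau>" "\<And>y. y \<in> B \<Longrightarrow> m \<le> (\<Sum>x\<in>{x\<in>X. \<bar>det x y\<bar> > \<tau>}. w x)"
    and tail: "step_const * (2 powr (7/2 - 2 * s))^k / (1 - 2 powr (7/2 - 2 * s)) < m^3 / (36 * L^6)"
  shows "\<exists>i\<in>cells ((1/2)^k/L). \<exists>j\<in>cells ((1/2)^k/L). \<forall>t1 t2. \<lfloor>t1 / ((1/2)^k/L)\<rfloor> = i \<and> \<lfloor>t2 / ((1/2)^k/L)\<rfloor> = j \<longrightarrow>
     (\<exists>x\<in>X. \<exists>y\<in>X. \<exists>z\<in>X. \<bar>det x y - t1\<bar> \<le> 2 * W * L * (1/2)^(k+n) \<and> \<bar>det z y - t2\<bar> \<le> 2 * W * L * (1/2)^(k+n))"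
proof -
  have "(1/2::real)^(k+n) \<le> (1/2)^k" by (intro power_decreasing) auto
  then have r: "\<delta> \<le> (1/2)^k" "(1/2::real)^k \<le> 1" "(1/2::real)^(k+n) \<le> 1" 
    using \<delta> power_le_one[of "1/2::real" k] power_le_one[of "1/2::real" "k+n"] by linarith+
  obtain i j where ij: "i \<in> cells ((1/2)^k/L)" "j \<in> cells ((1/2)^k/L)" 
    and lower: "\<forall>t1 t2. \<lfloor>t1 / ((1/2)^k/L)\<rfloor> = i \<and> \<lfloor>t2 / ((1/2)^k/L)\<rfloor> = j \<longrightarrow>
      1 / L \<le> \<bar>t1\<bar> \<and> 1 / L \<le> \<bar>t2\<bar> \<and> m^3 / (36 * L^6) \<le> pair_density B ((1/2)^k) t1 t2"
    using heavy_cell[OF B m \<tau> r(1,2)] by blast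
  show ?thesis
  proof (rule bexI[OF _ ij(1)], rule bexI[OF _ ij(2)], intro allI impI)
    fix t1 t2 assume "\<lfloor>t1 / ((1/2)^k/L)\<rfloor> = i \<and> \<lfloor>t2 / ((1/2)^k/L)\<rfloor> = j"
    then have t: "1 / L \<le> \<bar>t1\<bar>" "1 / L \<le> \<bar>t2\<bar>" and pair_density: "m^3 / (36 * L^6) \<le> pair_density B ((1/2)^k) t1 t2" using lower by auto
    have "0 < pair_density B ((1/2)^(k+n)) t1 t2"
      using pair_density_lower[OF t B(1,2) s \<delta>] pair_density tail by linarith
    then show "\<exists>x\<in>X. \<exists>y\<in>X. \<exists>z\<in>X. \<bar>det x y - t1\<bar> \<le> 2 * W * L * (1/2)^(k+n) \<and> \<bar>det z y - t2\<bar> \<le> 2 * W * L * (1/2)^(k+n)"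
      using B(1,2) \<delta> r(3) by (intro pair_density_pos_witness) auto
  qed
qed

end

section \<open>Choice of constants and passage to exact determinants\<close>

lemma small_powr:
  fixes K a \<epsilon> :: real
  assumes "0 < a" "0 < \<epsilon>"
  obtains \<rho> where "0 < \<rho>" "\<rho> \<le> 1" "K * \<rho> powr a \<le> \<epsilon>"
proof -
  define x where "x = \<epsilon> / max K 1"
  have x: "0 < x" using assms by (simp add: x_def)
  define \<rho> where "\<rho> = min 1 (x powr (1 / a))"
  have \<rho>: "0 < \<rho>" "\<rho> \<le> 1" using x by (auto simp: \<rho>_def)
  have "\<rho> powr a \<le> (x powr (1 / a)) powr a" using \<rho> assms by (intro powr_mono2) (auto simp: \<rho>_def)
  also have "\<dots> = x" using x assms by (simp add: powr_powr)
  finally have "max K 1 * \<rho> powr a \<le> \<epsilon>" by (simp add: x_def field_simps)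
  moreover have "K * \<rho> powr a \<le> max K 1 * \<rho> powr a" by (intro mult_right_mono) auto
  ultimately have "K * \<rho> powr a \<le> \<epsilon>" by linarith
  with \<rho> show ?thesis by (rule that)
qed

text \<open>The cell \<open>[i * h, (i + 1) * h)\<close> has 0 at most as an end point, never
  inside, so the halved modulus is affine on it; the sign of \<open>i\<close> selects the
  branch.\<close>

lemma half_abs_covers_interval:
  fixes h :: real
  assumes "0 < h"
  obtains a b where "a < b" "\<And>x. a < x \<Longrightarrow> x < b \<Longrightarrow> \<exists>t. \<lfloor>t / h\<rfloor> = i \<and> \<bar>t\<bar> / 2 = x"
proof (cases "0 \<le> i")
  case True
  show ?thesis
  proof (rule that[of "i * h / 2" "(i + 1) * h / 2"])
    show "i * h / 2 < (i + 1) * h / 2" using assms by simp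
    fix x assume x: "i * h / 2 < x" "x < (i + 1) * h / 2"
    have "0 \<le> i * h" using True assms by simp
    then have "\<bar>2 * x\<bar> / 2 = x" using x by simp
    moreover have "\<lfloor>2 * x / h\<rfloor> = i" using x assms by (intro floor_unique) (auto simp: field_simps)
    ultimately show "\<exists>t. \<lfloor>t / h\<rfloor> = i \<and> \<bar>t\<bar> / 2 = x" by blast
  qed
next
  case False
  show ?thesis
  proof (rule that[of "- (i + 1) * h / 2" "- i * h / 2"])
    show "- (i + 1) * h / 2 < - i * h / 2" using assms by (simp add: algebra_simps)
    fix x assume x: "- (i + 1) * h / 2 < x" "x < - i * h / 2"
    have "real_of_int (i + 1) * h \<le> 0" using False assms by (intro mult_nonpos_nonneg) auto
    moreover have "- (i + 1) * h = - (real_of_int (i + 1) * h)" by (simp only: of_int_minus mult_minus_left)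
    ultimately have "0 < x" using x(1) by linarith
    then have "\<bar>-2 * x\<bar> / 2 = x" by simp
    moreover have "\<lfloor>-2 * x / h\<rfloor> = i" using x assms by (intro floor_unique) (auto simp: field_simps)
    ultimately show "\<exists>t. \<lfloor>t / h\<rfloor> = i \<and> \<bar>t\<bar> / 2 = x" by blast
  qed
qed

lemma area_pairs_contain_cell:
  fixes E :: "(real^2) set"
  assumes E: "compact E" and p: "p \<in> E" and s: "7/4 < s" "s < 2" and C: "1 \<le> C" and c: "0 < c"
    and frost: "\<And>n. \<exists>X w. finite X \<and> X \<subseteq> E \<and> (\<forall>x\<in>X. 0 \<le> w x) \<and> c \<le> sum w X \<and>
     (\<forall>a b \<rho>. (1/2)^n \<le> \<rho> \<longrightarrow> (\<Sum>x\<in>{x\<in>X. \<bar>x$1 - a\<bar> \<le> \<rho> \<and> \<bar>x$2 - b\<bar> \<le> \<rho>}. w x) \<le> C * \<rho> powr s)"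
  shows "\<exists>h>0. \<exists>i j. \<forall>t1 t2. \<lfloor>t1 / h\<rfloor> = i \<and> \<lfloor>t2 / h\<rfloor> = j \<longrightarrow>
     (\<exists>x\<in>E. \<exists>y\<in>E. \<exists>z\<in>E. det2 (x - p) (y - p) = t1 \<and> det2 (z - p) (y - p) = t2)"
proof -
  define u v where "u = (\<lambda>x::real^2. x$1 - p$1)" and "v = (\<lambda>x::real^2. x$2 - p$2)"
  define m where "m = c / 2"
  have m: "0 < m" using c by (simp add: m_def)
  obtain L0 where L0: "1 \<le> L0" "\<And>x. x \<in> E \<Longrightarrow> \<bar>u x\<bar> \<le> L0 \<and> \<bar>v x\<bar> \<le> L0"
  proof -
    obtain M where M: "\<And>x. x \<in> E \<Longrightarrow> norm x \<le> M" using compact_imp_bounded[OF E] by (auto simp: bounded_iff)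
    have "\<bar>x$i - p$i\<bar> \<le> max 1 (2 * M)" if "x \<in> E" for x i
      using component_le_norm_cart[of x i] component_le_norm_cart[of p i] M[OF that] M[OF p] by linarith
    then show ?thesis using that[of "max 1 (2 * M)"] by (simp add: u_def v_def)
  qed
  \<comment> \<open>The order matters: \<rho> discards points near \<open>v = 0\<close> and fixes
    \<open>L1\<close>; \<sigma> then discards small determinants by a bound involving
    \<open>L1\<close>; the final \<open>L\<close> must also satisfy
    \<open>2 / L \<le> \<tau>\<close>.\<close>
  obtain \<rho> where \<rho>: "0 < \<rho>" "\<rho> \<le> 1" "4 * L0 * C * \<rho> powr (s - 1) \<le> m"
    using small_powr[of "s - 1" m "4 * L0 * C"] s m by auto
  define L1 where "L1 = max L0 (1 / \<rho>)"
  obtain \<sigma> where \<sigma>: "0 < \<sigma>" "\<sigma> \<le> 1" "4 * L1 * C * (1 + L1\<^sup>2)\<^sup>2 * \<sigma> powr (s - 1) \<le> m"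
    using small_powr[of "s - 1" m "4 * L1 * C * (1 + L1\<^sup>2)\<^sup>2"] s m by auto
  define \<tau> where "\<tau> = \<sigma> / L1"
  have L1: "L0 \<le> L1" "1 / \<rho> \<le> L1" "0 < L1" using L0 by (auto simp: L1_def)
  have \<tau>0: "0 < \<tau>" using \<sigma> L1 by (simp add: \<tau>_def)
  define L where "L = max L1 (2 / \<tau>)"
  have L: "L1 \<le> L" "2 / \<tau> \<le> L" "0 < L" using L1 by (auto simp: L_def)
  have inv: "1 / L1 \<le> \<rho>" "1 / L \<le> 1 / L1" "2 / L \<le> \<tau>"
    using L L1 \<rho> \<tau>0 by (auto simp: field_simps)
  define \<theta> where "\<theta> = 2 powr (7/2 - 2 * s)"
  have \<theta>: "0 < \<theta>" "\<theta> < 1" unfolding \<theta>_def using s powr_less_mono[of "7/2 - 2 * s" 0 2] by auto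
  \<comment> \<open>The step constant involves neither the points nor their weights, so
    \<open>k\<close> can be chosen before any of the finite sets.\<close>
  define K where "K = frostman_points.step_const s C L"
  have "(\<lambda>k. K * \<theta>^k / (1 - \<theta>)) \<longlonglongrightarrow> K * 0 / (1 - \<theta>)" using \<theta> by (intro tendsto_intros LIMSEQ_power_zero) auto
  then have "\<forall>\<^sub>F k in sequentially. K * \<theta>^k / (1 - \<theta>) < m^3 / (36 * L^6)"
    by (rule order_tendstoD) (use m L in simp)
  moreover have half: "(\<lambda>k. (1/2::real)^k) \<longlonglongrightarrow> 0" by (intro LIMSEQ_power_zero) auto
  have "\<forall>\<^sub>F k in sequentially. (1/2::real)^k < \<rho>" "\<forall>\<^sub>F k in sequentially. (1/2::real)^k < \<sigma>"
    using order_tendstoD(2)[OF half] \<rho> \<sigma> by auto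
  ultimately have "\<forall>\<^sub>F k in sequentially. K * \<theta>^k / (1 - \<theta>) < m^3 / (36 * L^6) \<and> (1/2)^k < \<rho> \<and> (1/2)^k < \<sigma>"
    by eventually_elim blast
  then obtain k where k: "K * \<theta>^k / (1 - \<theta>) < m^3 / (36 * L^6)" "(1/2)^k < \<rho>" "(1/2)^k < \<sigma>"
    by (auto simp: eventually_sequentially)
  define h where "h = (1/2)^k / L"
  have h0: "0 < h" using L by (simp add: h_def)
  define I where "I = {\<lfloor>-2 * L\<^sup>2 / h\<rfloor>..\<lfloor>2 * L\<^sup>2 / h\<rfloor>}"
  define A where "A = 2 * (L + 2) * L"
  have fI: "finite I" by (simp add: I_def)
  define d where "d = (\<lambda>x y. det2 (x - p) (y - p))"
  have hits: "\<exists>ij\<in>I \<times> I. \<forall>t1 t2. \<lfloor>t1 / h\<rfloor> = fst ij \<and> \<lfloor>t2 / h\<rfloor> = snd ij \<longrightarrow>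
      (\<exists>x\<in>E. \<exists>y\<in>E. \<exists>z\<in>E. \<bar>d x y - t1\<bar> \<le> A * (1/2)^(k+n) \<and> \<bar>d z y - t2\<bar> \<le> A * (1/2)^(k+n))" for n
  proof -
    obtain X w where X: "finite X" "X \<subseteq> E" "\<forall>x\<in>X. 0 \<le> w x" "c \<le> sum w X"
      and fr: "\<And>a b \<rho>. (1/2)^(k+n) \<le> \<rho> \<Longrightarrow> (\<Sum>x\<in>{x\<in>X. \<bar>x$1 - a\<bar> \<le> \<rho> \<and> \<bar>x$2 - b\<bar> \<le> \<rho>}. w x) \<le> C * \<rho> powr s"
      using frost[of "k + n"] by blast
    define \<delta> where "\<delta> = (1/2::real)^(k+n)"
    have "(1/2::real)^(k+n) \<le> (1/2)^k" by (intro power_decreasing) auto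
    then have \<delta>: "\<delta> \<le> \<rho>" "\<delta> \<le> \<sigma>" using k unfolding \<delta>_def by linarith+
    interpret S0: frostman_points X u v w s C L0 \<delta>
    proof
      show "(\<Sum>x\<in>{x\<in>X. \<bar>u x - a\<bar> \<le> \<rho> \<and> \<bar>v x - b\<bar> \<le> \<rho>}. w x) \<le> C * \<rho> powr s" if "\<delta> \<le> \<rho>" for a b \<rho>
        using fr[of \<rho> "a + p$1" "b + p$2"] that by (simp add: u_def v_def \<delta>_def algebra_simps)
    qed (use X L0 C s in \<open>auto simp: \<delta>_def power_le_one\<close>)
    interpret S1: frostman_points X u v w s C L1 \<delta> using L1(1) by (rule S0.mono_L)
    interpret S: frostman_points X u v w s C L \<delta> using L(1) by (rule S1.mono_L)
    define B where "B = {y\<in>X. \<not> \<bar>v y\<bar> \<le> \<rho>}"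
    \<comment> \<open>As \<open>c = 2 * m\<close>, discarding mass at most \<open>m\<close> leaves
      at least \<open>m\<close>.\<close>
    have heavy: "m \<le> sum w {x\<in>X. \<not> P x}" if "sum w {x\<in>X. P x} \<le> m" for P
    proof -
      have "sum w X = sum w {x\<in>X. P x} + sum w {x\<in>X. \<not> P x}"
        using X(1) by (subst sum.union_disjoint[symmetric]) (auto intro!: sum.cong)
      then show ?thesis using that X(4) by (simp add: m_def)
    qed
    have B1: "m \<le> sum w B" unfolding B_def
      using S0.horizontal_strip_mass[OF \<delta>(1) \<rho>(2)] \<rho>(3) by (intro heavy) linarith
    have vB: "1 / L1 \<le> \<bar>v y\<bar>" if "y \<in> B" for y using that inv(1) by (auto simp: B_def)
    have B2: "m \<le> (\<Sum>x\<in>{x\<in>X. \<bar>S.det x y\<bar> > \<tau>}. w x)" if y: "y \<in> B" for y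
    proof -
      have "y \<in> X" using y by (simp add: B_def)
      from S1.det_strip_mass[OF \<delta>(2) \<sigma>(2) this vB[OF y]] 
      have "sum w {x\<in>X. \<bar>S.det x y\<bar> \<le> \<tau>} \<le> m" using \<sigma>(3) unfolding \<tau>_def by linarith
      from heavy[OF this] show ?thesis by (simp add: not_le)
    qed
    have "\<exists>i\<in>S.cells ((1/2)^k/L). \<exists>j\<in>S.cells ((1/2)^k/L). \<forall>t1 t2. \<lfloor>t1 / ((1/2)^k/L)\<rfloor> = i \<and> \<lfloor>t2 / ((1/2)^k/L)\<rfloor> = j \<longrightarrow>
     (\<exists>x\<in>X. \<exists>y\<in>X. \<exists>z\<in>X. \<bar>S.det x y - t1\<bar> \<le> 2 * S.W * L * (1/2)^(k+n) \<and> \<bar>S.det z y - t2\<bar> \<le> 2 * S.W * L * (1/2)^(k+n))"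
    proof (rule S.approximate_hits[where B=B and \<tau>=\<tau> and m=m])
      show "1 / L \<le> \<bar>v y\<bar>" if "y \<in> B" for y using vB[OF that] inv(2) by linarith
      show "S.step_const * (2 powr (7/2 - 2 * s))^k / (1 - 2 powr (7/2 - 2 * s)) < m^3 / (36 * L^6)"
        using k(1) by (simp add: K_def \<theta>_def)
    qed (use s B1 B2 m inv(3) in \<open>auto simp: \<delta>_def B_def\<close>)
    then obtain i j where ij: "i \<in> I" "j \<in> I" "\<forall>t1 t2. \<lfloor>t1 / h\<rfloor> = i \<and> \<lfloor>t2 / h\<rfloor> = j \<longrightarrow>
     (\<exists>x\<in>X. \<exists>y\<in>X. \<exists>z\<in>X. \<bar>S.det x y - t1\<bar> \<le> A * (1/2)^(k+n) \<and> \<bar>S.det z y - t2\<bar> \<le> A * (1/2)^(k+n))"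
      unfolding I_def h_def A_def S.cells_def S.W_def by blast
    have "S.det x y = d x y" for x y
      unfolding S.det_def by (simp add: d_def det2_def u_def v_def)
    then show ?thesis using ij X(2) by (intro bexI[of _ "(i, j)"]) (simp, blast, simp)
  qed
  then obtain f where f: "\<And>n. f n \<in> I \<times> I" and fh: "\<And>n t1 t2. \<lfloor>t1 / h\<rfloor> = fst (f n) \<Longrightarrow> \<lfloor>t2 / h\<rfloor> = snd (f n) \<Longrightarrow>
      (\<exists>x\<in>E. \<exists>y\<in>E. \<exists>z\<in>E. \<bar>d x y - t1\<bar> \<le> A * (1/2)^(k+n) \<and> \<bar>d z y - t2\<bar> \<le> A * (1/2)^(k+n))"
    by metis
  \<comment> \<open>The cell may change with \<open>n\<close>; one of the finitely many candidates
    occurs for infinitely many \<open>n\<close>, and along these the error tends to 0.\<close>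
  have "finite (range f)" using f fI by (meson finite_SigmaI finite_subset image_subsetI)
  then obtain n0 where inf: "infinite {n. f n = f n0}"
    using pigeonhole_infinite[of UNIV f] by auto
  define G where "G = (\<lambda>(x, y, z). (d x y, d z y)) ` (E \<times> E \<times> E)"
  have "closed G" unfolding G_def d_def det2_def split_def
    by (intro compact_imp_closed compact_continuous_image compact_Times E continuous_intros)
  have "(t1, t2) \<in> G" if t: "\<lfloor>t1 / h\<rfloor> = fst (f n0)" "\<lfloor>t2 / h\<rfloor> = snd (f n0)" for t1 t2
  proof -
    have "\<exists>g\<in>G. dist g (t1, t2) < e" if e: "0 < e" for e
    proof -
      have "(\<lambda>n. A * (1/2)^k * (1/2)^n) \<longlonglongrightarrow> A * (1/2)^k * 0" by (intro tendsto_intros half)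
      then have "\<forall>\<^sub>F n in sequentially. A * (1/2)^k * (1/2)^n < e / 2" by (rule order_tendstoD) (use e in simp)
      then obtain n1 where n1: "\<And>n. n1 \<le> n \<Longrightarrow> A * (1/2)^(k+n) < e / 2"
        by (auto simp: eventually_sequentially power_add mult_ac)
      obtain n where n: "n1 \<le> n" "f n = f n0" using inf by (auto simp: infinite_nat_iff_unbounded_le)
      obtain x y z where xyz: "x \<in> E" "y \<in> E" "z \<in> E" 
        "\<bar>d x y - t1\<bar> \<le> A * (1/2)^(k+n)" "\<bar>d z y - t2\<bar> \<le> A * (1/2)^(k+n)"
        using fh[of t1 n t2] t n(2) by auto
      have "dist (d x y, d z y) (t1, t2) \<le> \<bar>d x y - t1\<bar> + \<bar>d z y - t2\<bar>"
        using sqrt_sum_squares_le_sum_abs[of "d x y - t1" "d z y - t2"] by (simp add: dist_Pair_Pair dist_real_def)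
      also have "\<dots> < e" using xyz n1[OF n(1)] by linarith
      finally show ?thesis using xyz unfolding G_def by (intro bexI[of _ "(d x y, d z y)"]) (auto simp: image_iff)
    qed
    then have "(t1, t2) \<in> closure G" by (simp add: closure_approachable)
    then show ?thesis using \<open>closed G\<close> by simp
  qed
  then show ?thesis using h0 unfolding G_def d_def
    by (intro exI[of _ h] conjI exI[of _ "fst (f n0)"] exI[of _ "snd (f n0)"]) (auto simp: image_iff, blast)
qed

theorem theorem1p5:
  fixes E :: "(real^2) set"
  assumes "compact E" and "hausdorff_dim E > 7/4"
  shows "interior {vector [\<bar>det2 (x - w) (y - w)\<bar> / 2, \<bar>det2 (y - w) (z - w)\<bar> / 2] :: real^2
                   | x y z w. x \<in> E \<and> y \<in> E \<and> z \<in> E \<and> w \<in> E} \<noteq> {}"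
    (is "interior ?S \<noteq> {}")
proof -
  obtain s \<delta> where s: "7/4 < s" "s < 2" and \<delta>: "0 < \<delta>" "hausdorff_pre s \<delta> E \<noteq> 0"
    using hausdorff_pre_pos[OF assms(2), of 2] by auto
  obtain c C where c: "0 < c" and C: "1 \<le> C" and frost: "\<And>n. \<exists>X w. finite X \<and> X \<subseteq> E \<and> (\<forall>x\<in>X. 0 \<le> w x) \<and> c \<le> sum w X \<and>
     (\<forall>a b \<rho>. (1/2)^n \<le> \<rho> \<longrightarrow> (\<Sum>x\<in>{x\<in>X. \<bar>x$1 - a\<bar> \<le> \<rho> \<and> \<bar>x$2 - b\<bar> \<le> \<rho>}. w x) \<le> C * \<rho> powr s)"
    using discrete_frostman[OF compact_imp_bounded[OF assms(1)] \<delta>] s by auto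
  have "E \<noteq> {}" using frost[of 0] c by auto
  \<comment> \<open>Any point of \<open>E\<close> can serve as the common vertex
    \<open>w\<close>.\<close>
  then obtain p where p: "p \<in> E" by blast
  obtain h i j where h: "0 < h" and cell: "\<And>t1 t2. \<lfloor>t1 / h\<rfloor> = i \<Longrightarrow> \<lfloor>t2 / h\<rfloor> = j \<Longrightarrow>
     (\<exists>x\<in>E. \<exists>y\<in>E. \<exists>z\<in>E. det2 (x - p) (y - p) = t1 \<and> det2 (z - p) (y - p) = t2)"
    using area_pairs_contain_cell[OF assms(1) p s C c frost] by blast
  obtain a b where ab: "a < b" "\<And>x. a < x \<Longrightarrow> x < b \<Longrightarrow> \<exists>t. \<lfloor>t / h\<rfloor> = i \<and> \<bar>t\<bar> / 2 = x"
    using half_abs_covers_interval[OF h, of i] by blast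
  obtain a' b' where ab': "a' < b'" "\<And>x. a' < x \<Longrightarrow> x < b' \<Longrightarrow> \<exists>t. \<lfloor>t / h\<rfloor> = j \<and> \<bar>t\<bar> / 2 = x"
    using half_abs_covers_interval[OF h, of j] by blast
  define U where "U = {q :: real^2. a < q$1 \<and> q$1 < b \<and> a' < q$2 \<and> q$2 < b'}"
  have "open U" unfolding U_def by (intro open_Collect_conj open_Collect_less continuous_intros)
  \<comment> \<open>The second determinant is wanted with its columns in the other order; the
    absolute value removes the sign.\<close>
  have anti: "det2 b a = - det2 a b" for a b by (simp add: det2_def)
  have "U \<subseteq> ?S"
  proof
    fix q assume "q \<in> U"
    then obtain t1 t2 where t: "\<lfloor>t1 / h\<rfloor> = i" "\<bar>t1\<bar> / 2 = q$1" "\<lfloor>t2 / h\<rfloor> = j" "\<bar>t2\<bar> / 2 = q$2"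
      using ab(2)[of "q$1"] ab'(2)[of "q$2"] by (auto simp: U_def)
    obtain x y z where xyz: "x \<in> E" "y \<in> E" "z \<in> E" "det2 (x - p) (y - p) = t1" "det2 (z - p) (y - p) = t2"
      using cell[OF t(1,3)] by blast
    have "q = vector [\<bar>det2 (x - p) (y - p)\<bar> / 2, \<bar>det2 (y - p) (z - p)\<bar> / 2]"
      using t xyz anti[of "y - p" "z - p"] by (simp add: vec_eq_iff forall_2)
    then show "q \<in> ?S" using xyz p by blast
  qed
  then have "U \<subseteq> interior ?S" using \<open>open U\<close> by (rule interior_maximal)
  moreover have "vector [(a + b) / 2, (a' + b') / 2] \<in> U" using ab(1) ab'(1) by (simp add: U_def)
  ultimately show ?thesis by blast
qed

end
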